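(* Suppose $p\colon \mathbb{N} \to (1,\infty)$ is a fast-growing order function such that $\sum_{n=0}^\infty p(n)^{-1}$ is a recursive real. Then for any order function $\tilde{p}\colon \mathbb{N} \to (1,\infty)$ such that $p(n)/\tilde{p}(n) \nearrow \infty$ as $n \to \infty$ and for which $\sum_{n=0}^\infty \tilde{p}(n)^{-1}$ is a recursive real, $$\mathrm{LUA}(p) \leq_{\mathrm{s}} \mathrm{COMPLEX}\bigl(\lambda n.\, \log_2 \tilde{p}\bigl(p^{\mathrm{inv}}(2^{n+1})-1\bigr)\bigr).$$ Moreover, such a $\tilde{p}$ exists, and for any such $\tilde{p}$ the function $\lambda n.\, \log_2 \tilde{p}(p^{\mathrm{inv}}(2^{n+1})-1)$ is dominated by a convex sub-identical recursive function $g \colon \mathbb{N} \to [0,\infty)$.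
   Context: An order function is a computable (i.e. its values are uniformly computable reals), nondecreasing, unbounded function $\mathbb{N}\to\mathbb{R}$. An order function $p\colon\mathbb{N}\to(1,\infty)$ is fast-growing if $\sum_{n=0}^\infty p(n)^{-1}<\infty$. A real is recursive if it is computable, and a function $g\colon\mathbb{N}\to\mathbb{R}$ is recursive if its values are uniformly computable reals. $a_n\nearrow\infty$ means that $(a_n)$ is nondecreasing and tends to $\infty$. $p^{\mathrm{inv}}(x)$ is the least $m\in\mathbb{N}$ with $p(m)\geq x$. A function $g\colon\mathbb{N}\to[0,\infty)$ is sub-identical if $\lim_{n\to\infty}(n-g(n))=\infty$; a nondecreasing $g$ is convex if $g(n+1)-g(n)\leq 1$ for all $n$. $f$ is dominated by $g$ if $f(n)\leq g(n)$ for all but finitely many $n$. Prefix-free complexity: a prefix-free machine is a partial recursive $M$ from $\{0,1\}^*$ to $\{0,1\}^*$ with prefix-free domain; $U$ is universal if for each prefix-free machine $M$ there is $\rho$ with $U(\rho^\frown\tau)\simeq M(\tau)$ for all $\tau$. Fix a universal $U$ and let $K(\sigma)=\min\{|\tau| : U(\tau)=\sigma\}$. For $f\colon\mathbb{N}\to\mathbb{R}$, $\mathrm{COMPLEX}(f)$ is the set of $X\in\{0,1\}^{\mathbb{N}}$ for which there is $c\in\mathbb{N}$ with $K(X\upharpoonright n)\geq f(n)-c$ for all $n$. Convention: finitely many values of $f$ are irrelevant; if $f$ is only defined for $n\geq a$, values for $n<a$ are set to $f(a)$. A partial recursive $\psi\colon\subseteq\mathbb{N}\to\mathbb{N}$ is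 linearly universal if for every partial recursive $\theta\colon\subseteq\mathbb{N}\to\mathbb{N}$ there are $a,b\in\mathbb{N}$ with $\psi(ax+b)\simeq\theta(x)$ for all $x$. For $p\colon\mathbb{N}\to(1,\infty)$, $\mathrm{LUA}(p)$ is the set of $X\in\mathbb{N}^{\mathbb{N}}$ such that $X(n)<p(n)$ for all $n$ and, for some linearly universal partial recursive $\psi$, there is no $n\in\operatorname{dom}\psi$ with $X(n)=\psi(n)$. For $P,Q\subseteq\mathbb{N}^{\mathbb{N}}$, $P\leq_{\mathrm{s}}Q$ means there is a partial recursive functional defined on all of $Q$ that maps $Q$ into $P$. *)

theory Defs
  imports Complex_Main "HOL-Library.Nat_Bijection" "HOL-Library.Sublist"
begin

text \<open>
  Kleene's mu-recursive functions with an oracle. Programs compute unary functions; several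
  arguments are passed through the bijection \<^const>\<open>prod_encode\<close>. The identity is
  \<open>PPair PFst PSnd\<close>.
\<close>

datatype prog =
    PZero
  | PSucc
  | PFst
  | PSnd
  | POracle
  | PPair prog prog
  | PComp prog prog
  | PRec prog prog
  | PMu prog

primrec run :: "prog \<Rightarrow> (nat \<Rightarrow> nat) \<Rightarrow> nat \<Rightarrow> nat option" where
  "run PZero X n = Some 0"
| "run PSucc X n = Some (Suc n)"
| "run PFst X n = Some (fst (prod_decode n))"
| "run PSnd X n = Some (snd (prod_decode n))"
| "run POracle X n = Some (X n)"
| "run (PPair d e) X n =
     Option.bind (run d X n) (\<lambda>a. Option.bind (run e X n) (\<lambda>b. Some (prod_encode (a, b))))"
| "run (PComp d e) X n = Option.bind (run e X n) (run d X)"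
| "run (PRec d e) X n =
     (let (a, k) = prod_decode n in
      rec_nat (run d X a)
        (\<lambda>m r. Option.bind r (\<lambda>y. run e X (prod_encode (a, prod_encode (m, y))))) k)"
| "run (PMu e) X n =
     (let P = (\<lambda>k. run e X (prod_encode (n, k)) = Some 0 \<and>
                   (\<forall>j<k. \<exists>y. run e X (prod_encode (n, j)) = Some (Suc y)))
      in if \<exists>k. P k then Some (LEAST k. P k) else None)"

primrec oracle_free :: "prog \<Rightarrow> bool" where
  "oracle_free PZero = True"
| "oracle_free PSucc = True"
| "oracle_free PFst = True"
| "oracle_free PSnd = True"
| "oracle_free POracle = False"
| "oracle_free (PPair d e) = (oracle_free d \<and> oracle_free e)"
| "oracle_free (PComp d e) = (oracle_free d \<and> oracle_free e)"
| "oracle_free (PRec d e) = (oracle_free d \<and> oracle_free e)"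
| "oracle_free (PMu e) = oracle_free e"

definition partial_recursive :: "(nat \<Rightarrow> nat option) \<Rightarrow> bool" where
  "partial_recursive \<psi> \<longleftrightarrow> (\<exists>e. oracle_free e \<and> (\<forall>X. run e X = \<psi>))"

definition total_recursive :: "(nat \<Rightarrow> nat) \<Rightarrow> bool" where
  "total_recursive \<phi> \<longleftrightarrow> partial_recursive (\<lambda>n. Some (\<phi> n))"

definition partial_recursive_functional :: "((nat \<Rightarrow> nat) \<Rightarrow> nat \<Rightarrow> nat option) \<Rightarrow> bool" where
  "partial_recursive_functional \<Phi> \<longleftrightarrow> (\<exists>e. run e = \<Phi>)"

text \<open>
  Strong (Medvedev) reducibility. A functional is defined at \<open>X\<close> when its value there is a
  total sequence.
\<close>

definition strongly_reducible :: "(nat \<Rightarrow> nat) set \<Rightarrow> (nat \<Rightarrow> nat) set \<Rightarrow> bool"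
    (infix "\<le>\<^sub>s" 50) where
  "P \<le>\<^sub>s Q \<longleftrightarrow>
     (\<exists>\<Phi>. partial_recursive_functional \<Phi> \<and> (\<forall>X\<in>Q. \<exists>Y\<in>P. \<Phi> X = (\<lambda>n. Some (Y n))))"

definition rational_of_code :: "nat \<Rightarrow> real" where
  "rational_of_code m =
     (let (s, d) = prod_decode m in real_of_int (int_decode s) / real (Suc d))"

definition recursive_real :: "real \<Rightarrow> bool" where
  "recursive_real x \<longleftrightarrow>
     (\<exists>\<phi>. total_recursive \<phi> \<and> (\<forall>k. \<bar>x - rational_of_code (\<phi> k)\<bar> \<le> 1 / 2 ^ k))"

definition recursive_real_function :: "(nat \<Rightarrow> real) \<Rightarrow> bool" where
  "recursive_real_function g \<longleftrightarrow>
     (\<exists>\<phi>. total_recursive \<phi> \<and>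
        (\<forall>n k. \<bar>g n - rational_of_code (\<phi> (prod_encode (n, k)))\<bar> \<le> 1 / 2 ^ k))"

definition order_function :: "(nat \<Rightarrow> real) \<Rightarrow> bool" where
  "order_function p \<longleftrightarrow> recursive_real_function p \<and> mono p \<and> (\<forall>B. \<exists>n. B < p n)"

definition fast_growing :: "(nat \<Rightarrow> real) \<Rightarrow> bool" where
  "fast_growing p \<longleftrightarrow>
     order_function p \<and> (\<forall>n. 1 < p n) \<and> summable (\<lambda>n. inverse (p n))"

definition increases_to_infinity :: "(nat \<Rightarrow> real) \<Rightarrow> bool" where
  "increases_to_infinity a \<longleftrightarrow> mono a \<and> filterlim a at_top sequentially"

definition pinv :: "(nat \<Rightarrow> real) \<Rightarrow> real \<Rightarrow> nat" where
  "pinv p x = (LEAST m. x \<le> p m)"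

definition sub_identical :: "(nat \<Rightarrow> real) \<Rightarrow> bool" where
  "sub_identical g \<longleftrightarrow> (\<forall>n. 0 \<le> g n) \<and> filterlim (\<lambda>n. real n - g n) at_top sequentially"

definition convex_order :: "(nat \<Rightarrow> real) \<Rightarrow> bool" where
  "convex_order g \<longleftrightarrow> mono g \<and> (\<forall>n. g (n + 1) - g n \<le> 1)"

definition dominated_by :: "(nat \<Rightarrow> real) \<Rightarrow> (nat \<Rightarrow> real) \<Rightarrow> bool" where
  "dominated_by f g \<longleftrightarrow> (\<forall>\<^sub>F n in sequentially. f n \<le> g n)"

definition string_code :: "bool list \<Rightarrow> nat" where
  "string_code \<sigma> = list_encode (map of_bool \<sigma>)"

definition prefix_free_machine :: "(bool list \<Rightarrow> bool list option) \<Rightarrow> bool" where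
  "prefix_free_machine M \<longleftrightarrow>
     (\<exists>\<psi>. partial_recursive \<psi> \<and> (\<forall>\<sigma>. \<psi> (string_code \<sigma>) = map_option string_code (M \<sigma>))) \<and>
     (\<forall>\<sigma>\<in>dom M. \<forall>\<tau>\<in>dom M. prefix \<sigma> \<tau> \<longrightarrow> \<sigma> = \<tau>)"

definition universal_machine :: "(bool list \<Rightarrow> bool list option) \<Rightarrow> bool" where
  "universal_machine U \<longleftrightarrow>
     prefix_free_machine U \<and>
     (\<forall>M. prefix_free_machine M \<longrightarrow> (\<exists>\<rho>. \<forall>\<tau>. U (\<rho> @ \<tau>) = M \<tau>))"

definition prefix_complexity :: "(bool list \<Rightarrow> bool list option) \<Rightarrow> bool list \<Rightarrow> nat" where
  "prefix_complexity U \<sigma> = (LEAST l. \<exists>\<tau>. length \<tau> = l \<and> U \<tau> = Some \<sigma>)"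

text \<open>Binary sequences are regarded as elements of Baire space with values in \<open>{0, 1}\<close>.\<close>

definition COMPLEX ::
    "(bool list \<Rightarrow> bool list option) \<Rightarrow> (nat \<Rightarrow> real) \<Rightarrow> (nat \<Rightarrow> nat) set" where
  "COMPLEX U f =
     {(\<lambda>n. of_bool (X n)) | X :: nat \<Rightarrow> bool.
        \<exists>c::nat. \<forall>n. real (prefix_complexity U (map X [0..<n])) \<ge> f n - real c}"

definition linearly_universal :: "(nat \<Rightarrow> nat option) \<Rightarrow> bool" where
  "linearly_universal \<psi> \<longleftrightarrow>
     partial_recursive \<psi> \<and>
     (\<forall>\<theta>. partial_recursive \<theta> \<longrightarrow> (\<exists>a b. \<forall>x. \<psi> (a * x + b) = \<theta> x))"

definition LUA :: "(nat \<Rightarrow> real) \<Rightarrow> (nat \<Rightarrow> nat) set" where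
  "LUA p =
     {X. (\<forall>n. real (X n) < p n) \<and>
         (\<exists>\<psi>. linearly_universal \<psi> \<and> \<not> (\<exists>n\<in>dom \<psi>. \<psi> n = Some (X n)))}"

definition summable_companion :: "(nat \<Rightarrow> real) \<Rightarrow> (nat \<Rightarrow> real) \<Rightarrow> bool" where
  "summable_companion p q \<longleftrightarrow>
     order_function q \<and> (\<forall>n. 1 < q n) \<and>
     increases_to_infinity (\<lambda>n. p n / q n) \<and>
     summable (\<lambda>n. inverse (q n)) \<and> recursive_real (\<Sum>n. inverse (q n))"

text \<open>
  The expression \<open>log 2 (q (pinv p (2 ^ (n + 1)) - 1))\<close> makes sense only if
  \<open>pinv p (2 ^ (n + 1)) > 0\<close>, which holds from some least \<open>a\<close> on. Below \<open>a\<close> the function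
  takes its value at \<open>a\<close>, so the natural number subtraction never truncates.
\<close>

definition complexity_bound :: "(nat \<Rightarrow> real) \<Rightarrow> (nat \<Rightarrow> real) \<Rightarrow> nat \<Rightarrow> real" where
  "complexity_bound p q n =
     (let a = (LEAST a. 0 < pinv p (2 ^ (a + 1)))
      in log 2 (q (pinv p (2 ^ (max a n + 1)) - 1)))"

end

theory Submission
  imports Defs
begin

text \<open>
  Let \<open>\<psi>\<close> be linearly universal and let \<open>Y m\<close> be the number of the longest initial segment of \<open>X\<close>
  whose number is guaranteed to be less than \<open>p m\<close>. Since \<open>1 / q\<close> is summable, the Kraft inequality
  gives \<open>m\<close> a self-delimiting code of about \<open>log 2 (q m)\<close> bits, and if \<open>\<psi> m = Y m\<close> then this code
  describes a segment whose complexity bound is at least \<open>log 2 (q m)\<close>. To turn this into a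
  contradiction \<open>\<psi>\<close> is moved to the multiples of a large \<open>a\<close>: it remains linearly universal, while the
  sum of \<open>1 / q\<close> over the positive multiples of \<open>a\<close> shrinks by the factor \<open>a\<close>, which saves \<open>log 2 a\<close>
  bits at the cost of describing \<open>a\<close>.

  A companion of \<open>p\<close> is obtained by dividing \<open>p\<close> by powers of two chosen according to the tail of the
  series \<open>1 / p\<close>, which is a recursive function because the sum is recursive. The complexity bound
  differs from \<open>n\<close> by at least the logarithm of \<open>p / q\<close>, up to a constant, at an argument tending to
  infinity; a counter that moves up by at most one per step bounds this difference recursively.
\<close>

section \<open>Closure properties of the recursive functions\<close>

abbreviation pfst :: "nat \<Rightarrow> nat" where "pfst n \<equiv> fst (prod_decode n)"
abbreviation psnd :: "nat \<Rightarrow> nat" where "psnd n \<equiv> snd (prod_decode n)"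

lemma total_recursiveI: "oracle_free e \<Longrightarrow> (\<And>X n. run e X n = Some (f n)) \<Longrightarrow> total_recursive f"
  unfolding total_recursive_def partial_recursive_def by (auto simp: fun_eq_iff)

lemma total_recursiveE:
  assumes "total_recursive f"
  obtains e where "oracle_free e" "run e = (\<lambda>X n. Some (f n))"
  using assms unfolding total_recursive_def partial_recursive_def by (auto simp: fun_eq_iff)

lemma partial_recursiveI: "oracle_free e \<Longrightarrow> (\<And>X n. run e X n = \<psi> n) \<Longrightarrow> partial_recursive \<psi>"
  unfolding partial_recursive_def by (auto simp: fun_eq_iff)

lemma partial_recursiveE:
  assumes "partial_recursive \<psi>"
  obtains e where "oracle_free e" "run e = (\<lambda>X n. \<psi> n)"
  using assms unfolding partial_recursive_def by (auto simp: fun_eq_iff)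

lemma tr_id: "total_recursive (\<lambda>n. n)"
  by (rule total_recursiveI[of "PPair PFst PSnd"]) auto

lemma tr_comp:
  assumes "total_recursive h" "total_recursive f"
  shows "total_recursive (\<lambda>n. h (f n))"
proof -
  obtain d where d: "oracle_free d" "run d = (\<lambda>X n. Some (h n))"
    using assms(1) by (rule total_recursiveE)
  obtain e where e: "oracle_free e" "run e = (\<lambda>X n. Some (f n))"
    using assms(2) by (rule total_recursiveE)
  show ?thesis by (rule total_recursiveI[of "PComp d e"]) (use d e in auto)
qed

lemma tr_pair:
  assumes "total_recursive f" "total_recursive g"
  shows "total_recursive (\<lambda>n. prod_encode (f n, g n))"
proof -
  obtain d where d: "oracle_free d" "run d = (\<lambda>X n. Some (f n))"
    using assms(1) by (rule total_recursiveE)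
  obtain e where e: "oracle_free e" "run e = (\<lambda>X n. Some (g n))"
    using assms(2) by (rule total_recursiveE)
  show ?thesis by (rule total_recursiveI[of "PPair d e"]) (use d e in auto)
qed

lemma tr_Suc: "total_recursive f \<Longrightarrow> total_recursive (\<lambda>n. Suc (f n))"
  by (rule tr_comp[OF total_recursiveI[of PSucc]]) auto

lemma tr_fst: "total_recursive f \<Longrightarrow> total_recursive (\<lambda>n. pfst (f n))"
  by (rule tr_comp[OF total_recursiveI[of PFst]]) auto

lemma tr_snd: "total_recursive f \<Longrightarrow> total_recursive (\<lambda>n. psnd (f n))"
  by (rule tr_comp[OF total_recursiveI[of PSnd]]) auto

lemma tr_const: "total_recursive (\<lambda>n. c)"
proof (induction c)
  case 0
  show ?case by (rule total_recursiveI[of PZero]) auto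
next
  case (Suc c)
  then show ?case by (rule tr_Suc)
qed

text \<open>\<open>PRec\<close> carries its parameter unchanged beside the counter, so running it on
  the pair of \<open>n\<close> and \<open>b n\<close> lets start, step and number of steps all
  depend on \<open>n\<close>.\<close>

lemma tr_rec:
  assumes "total_recursive f"
    and "total_recursive (\<lambda>z. h (pfst z) (pfst (psnd z)) (psnd (psnd z)))"
    and "total_recursive b"
  shows "total_recursive (\<lambda>n. rec_nat (f n) (h n) (b n))"
proof -
  obtain d where d: "oracle_free d" "run d = (\<lambda>X n. Some (f n))"
    using assms(1) by (rule total_recursiveE)
  obtain e where e: "oracle_free e"
    "run e = (\<lambda>X z. Some (h (pfst z) (pfst (psnd z)) (psnd (psnd z))))"
    using assms(2) by (rule total_recursiveE)
  have "rec_nat (run d X a)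
      (\<lambda>m r. Option.bind r (\<lambda>y. run e X (prod_encode (a, prod_encode (m, y))))) k =
      Some (rec_nat (f a) (h a) k)" for X a k
    by (induction k) (auto simp: d e)
  then have "total_recursive (\<lambda>z. rec_nat (f (pfst z)) (h (pfst z)) (psnd z))"
    by (intro total_recursiveI[of "PRec d e"]) (auto simp: d e split: prod.split)
  from tr_comp[OF this tr_pair[OF tr_id assms(3)]] show ?thesis by simp
qed

lemma tr_pred: "total_recursive f \<Longrightarrow> total_recursive (\<lambda>n. f n - 1)"
proof -
  have eq: "rec_nat 0 (\<lambda>m y. m) k = k - 1" for k :: nat by (cases k) auto
  have "total_recursive (\<lambda>n. rec_nat 0 (\<lambda>m y. m) n)"
    by (intro tr_rec tr_const tr_id tr_fst tr_snd)
  then show "total_recursive f \<Longrightarrow> total_recursive (\<lambda>n. f n - 1)"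
    unfolding eq by (rule tr_comp)
qed

lemma tr_add:
  assumes "total_recursive f" "total_recursive g"
  shows "total_recursive (\<lambda>n. f n + g n)"
proof -
  have eq: "rec_nat a (\<lambda>m y. Suc y) b = a + b" for a b by (induction b) auto
  have "total_recursive (\<lambda>n. rec_nat (f n) (\<lambda>m y. Suc y) (g n))"
    by (intro tr_rec tr_Suc tr_id tr_snd assms)
  then show ?thesis unfolding eq .
qed

lemma tr_diff:
  assumes "total_recursive f" "total_recursive g"
  shows "total_recursive (\<lambda>n. f n - g n)"
proof -
  have eq: "rec_nat a (\<lambda>m y. y - 1) b = a - b" for a b :: nat by (induction b) auto
  have "total_recursive (\<lambda>n. rec_nat (f n) (\<lambda>m y. y - 1) (g n))"
    by (intro tr_rec tr_pred tr_id tr_snd assms)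
  then show ?thesis unfolding eq .
qed

lemma tr_mult:
  assumes "total_recursive f" "total_recursive g"
  shows "total_recursive (\<lambda>n. f n * g n)"
proof -
  have eq: "rec_nat 0 (\<lambda>m y. y + a) b = a * b" for a b :: nat by (induction b) auto
  have "total_recursive (\<lambda>n. rec_nat 0 (\<lambda>m y. y + f n) (g n))"
    by (intro tr_rec tr_add tr_const tr_id tr_snd tr_fst assms tr_comp[OF assms(1)])
  then show ?thesis unfolding eq .
qed

lemma tr_power:
  assumes "total_recursive f" "total_recursive g"
  shows "total_recursive (\<lambda>n. f n ^ g n)"
proof -
  have eq: "rec_nat 1 (\<lambda>m y. y * a) b = a ^ b" for a b :: nat by (induction b) auto
  have "total_recursive (\<lambda>n. rec_nat 1 (\<lambda>m y. y * f n) (g n))"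
    by (intro tr_rec tr_mult tr_const tr_id tr_snd tr_fst assms tr_comp[OF assms(1)])
  then show ?thesis unfolding eq .
qed

lemma tr_sum:
  assumes "total_recursive (\<lambda>z. f (pfst z) (psnd z))" "total_recursive b"
  shows "total_recursive (\<lambda>n. \<Sum>i<b n. f n i)"
proof -
  have eq: "rec_nat 0 (\<lambda>m y. y + g m) k = (\<Sum>i<k. g i)" for g :: "nat \<Rightarrow> nat" and k
    by (induction k) auto
  have *: "total_recursive (\<lambda>z. f (pfst z) (pfst (psnd z)))"
    using tr_comp[OF assms(1), of "\<lambda>z. prod_encode (pfst z, pfst (psnd z))"]
    by (simp add: tr_pair tr_fst tr_snd tr_id)
  have "total_recursive (\<lambda>n. rec_nat 0 (\<lambda>m y. y + f n m) (b n))"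
    by (intro tr_rec tr_add tr_const tr_id tr_snd assms *)
  then show ?thesis unfolding eq .
qed

section \<open>Decidable predicates and bounded quantification\<close>

definition decidable :: "(nat \<Rightarrow> bool) \<Rightarrow> bool" where
  "decidable P \<longleftrightarrow> total_recursive (\<lambda>n. of_bool (P n))"

lemma tr_if:
  assumes "decidable P" "total_recursive f" "total_recursive g"
  shows "total_recursive (\<lambda>n. if P n then f n else g n)"
proof -
  have eq: "(if P n then f n else g n) = of_bool (P n) * f n + (1 - of_bool (P n)) * g n" for n
    by auto
  show ?thesis unfolding eq
    by (intro tr_add tr_mult tr_diff tr_const assms[unfolded decidable_def])
qed

lemma dec_le:
  assumes "total_recursive f" "total_recursive g"
  shows "decidable (\<lambda>n. f n \<le> g n)"
proof -
  have eq: "of_bool (f n \<le> g n) = 1 - (f n - g n)" for n by auto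
  show ?thesis unfolding eq decidable_def by (intro tr_diff tr_const assms)
qed

lemma dec_less:
  assumes "total_recursive f" "total_recursive g"
  shows "decidable (\<lambda>n. f n < g n)"
  using dec_le[OF tr_Suc[OF assms(1)] assms(2)] by (simp add: Suc_le_eq)

lemma dec_conj: "decidable P \<Longrightarrow> decidable Q \<Longrightarrow> decidable (\<lambda>n. P n \<and> Q n)"
  unfolding decidable_def of_bool_conj by (rule tr_mult)

lemma dec_disj: 
  assumes "decidable P" "decidable Q" shows "decidable (\<lambda>n. P n \<or> Q n)"
proof -
  have eq: "of_bool (P n \<or> Q n) = (if P n then 1 else of_bool (Q n))" for n by auto
  show ?thesis unfolding decidable_def eq
    by (intro tr_if tr_const assms assms(2)[unfolded decidable_def])
qed

lemma dec_eq:
  assumes "total_recursive f" "total_recursive g"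
  shows "decidable (\<lambda>n. f n = g n)"
  unfolding order_eq_iff by (intro dec_conj dec_le assms)

lemma dec_ex:
  assumes "decidable (\<lambda>z. P (pfst z) (psnd z))" "total_recursive b"
  shows "decidable (\<lambda>n. \<exists>i\<le>b n. P n i)"
proof -
  have "(\<exists>i\<le>b n. P n i) \<longleftrightarrow> 0 < (\<Sum>i<Suc (b n). of_bool (P n i) :: nat)" for n
    by (simp only: neq0_conv[symmetric] sum_eq_0_iff finite_lessThan) (auto simp: less_Suc_eq_le)
  then show ?thesis
    by (simp only:) (intro dec_less tr_const tr_sum tr_Suc assms[unfolded decidable_def])
qed

section \<open>Partial recursive functions and unbounded search\<close>

lemma pr_comp:
  assumes "partial_recursive \<psi>" "partial_recursive \<phi>"
  shows "partial_recursive (\<lambda>n. Option.bind (\<phi> n) \<psi>)"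
proof -
  obtain d where d: "oracle_free d" "run d = (\<lambda>X n. \<psi> n)"
    using assms(1) by (rule partial_recursiveE)
  obtain e where e: "oracle_free e" "run e = (\<lambda>X n. \<phi> n)"
    using assms(2) by (rule partial_recursiveE)
  have "run d X = \<psi>" for X using d by auto
  then show ?thesis by (intro partial_recursiveI[of "PComp d e"]) (use d e in auto)
qed

lemma pr_total: "total_recursive f \<Longrightarrow> partial_recursive (\<lambda>n. Some (f n))"
  unfolding total_recursive_def .

lemma pr_comp_total: "partial_recursive \<psi> \<Longrightarrow> total_recursive f \<Longrightarrow> partial_recursive (\<lambda>n. \<psi> (f n))"
  using pr_comp[OF _ pr_total] by fastforce

lemma pr_map:
  assumes "total_recursive (\<lambda>z. f (pfst z) (psnd z))" "partial_recursive \<psi>"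
  shows "partial_recursive (\<lambda>n. map_option (f n) (\<psi> n))"
proof -
  obtain e where e: "oracle_free e" "run e = (\<lambda>X n. \<psi> n)"
    using assms(2) by (rule partial_recursiveE)
  have "partial_recursive (\<lambda>n. map_option (\<lambda>y. prod_encode (n, y)) (\<psi> n))"
    by (rule partial_recursiveI[of "PPair (PPair PFst PSnd) e"])
      (auto simp: e map_conv_bind_option comp_def)
  from pr_comp[OF pr_total[OF assms(1)] this] show ?thesis
    by (simp add: map_conv_bind_option comp_def)
qed

text \<open>\<open>PMu\<close> looks for a zero, hence the complemented indicator. As this is total,
  the demand that earlier values be defined and positive only says that \<open>P\<close> fails
  earlier.\<close>

lemma pr_search:
  assumes "decidable (\<lambda>z. P (pfst z) (psnd z))"
  shows "partial_recursive (\<lambda>n. if \<exists>k. P n k then Some (LEAST k. P n k) else None)"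
proof -
  have "total_recursive (\<lambda>z. 1 - of_bool (P (pfst z) (psnd z)))"
    by (intro tr_diff tr_const assms[unfolded decidable_def])
  then obtain e where e: "oracle_free e"
    "run e = (\<lambda>X z. Some (1 - of_bool (P (pfst z) (psnd z))))"
    by (rule total_recursiveE)
  let ?Q = "\<lambda>n k. P n k \<and> (\<forall>j<k. \<not> P n j)"
  have Q: "(run e X (prod_encode (n, k)) = Some 0 \<and>
      (\<forall>j<k. \<exists>y. run e X (prod_encode (n, j)) = Some (Suc y))) = ?Q n k" for X n k
    by (auto simp: e)
  have ex: "(\<exists>k. ?Q n k) \<longleftrightarrow> (\<exists>k. P n k)" for n
    by (meson exists_least_iff)
  have "(LEAST k. ?Q n k) = (LEAST k. P n k)" if "\<exists>k. P n k" for n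
  proof (rule Least_equality)
    show "?Q n (LEAST k. P n k)" using LeastI_ex[OF that] not_less_Least by blast
  qed (simp add: Least_le)
  then show ?thesis
    by (intro partial_recursiveI[of "PMu e"]) (auto simp: e(1) Q ex Let_def)
qed

lemma tr_Least:
  assumes "decidable (\<lambda>z. P (pfst z) (psnd z))" "\<And>n. \<exists>k. P n k"
  shows "total_recursive (\<lambda>n. LEAST k. P n k)"
  using pr_search[OF assms(1)] assms(2) unfolding total_recursive_def by simp

lemma tr_div:
  assumes "total_recursive f" "total_recursive g"
  shows "total_recursive (\<lambda>n. f n div g n)"
proof -
  \<comment> \<open>The disjunct \<open>b = 0\<close> agrees with \<open>a div 0 = 0\<close> and
    keeps the search total.\<close>
  have eq: "a div b = (LEAST k. b = 0 \<or> a < Suc k * b)" for a b :: nat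
  proof (cases "b = 0")
    case False
    then have "(b = 0 \<or> a < Suc k * b) \<longleftrightarrow> a div b \<le> k" for k
      by (simp add: div_less_iff_less_mult flip: less_Suc_eq_le)
    then show ?thesis by (simp only:) (rule Least_equality[symmetric], auto)
  qed simp
  show ?thesis unfolding eq
  proof (rule tr_Least)
    show "\<exists>k. g n = 0 \<or> f n < Suc k * g n" for n
      by (rule exI[of _ "f n"], cases "g n") auto
  qed (intro dec_disj dec_eq dec_less tr_mult tr_Suc tr_const tr_snd tr_fst tr_id
      tr_comp[OF assms(1)] tr_comp[OF assms(2)])
qed

lemma tr_mod:
  assumes "total_recursive f" "total_recursive g"
  shows "total_recursive (\<lambda>n. f n mod g n)"
  unfolding minus_div_mult_eq_mod[symmetric] by (intro tr_diff tr_mult tr_div assms)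

lemmas tr_intros = tr_const tr_id tr_Suc tr_fst tr_snd tr_pair tr_add tr_diff tr_mult tr_power
  tr_div tr_mod tr_if tr_sum tr_rec dec_le dec_less dec_eq dec_conj dec_disj dec_ex

text \<open>Decoding by unbounded search: no separate proof that the inverse of \<open>w\<close> is recursive is needed.\<close>

lemma partial_recursive_transport:
  assumes "total_recursive w" "inj w" "partial_recursive \<psi>"
  shows "\<exists>\<phi>. partial_recursive \<phi> \<and> (\<forall>z. \<phi> (w z) = \<psi> z) \<and> (\<forall>m. m \<notin> range w \<longrightarrow> \<phi> m = None)"
proof -
  let ?s = "\<lambda>m. if \<exists>z. w z = m then Some (LEAST z. w z = m) else None"
  have "partial_recursive ?s"
    by (rule pr_search) (intro tr_intros tr_comp[OF assms(1)])
  then have "partial_recursive (\<lambda>m. Option.bind (?s m) \<psi>)"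
    by (rule pr_comp[OF assms(3)])
  moreover have "(LEAST z'. w z' = w z) = z" for z
    using assms(2) by (intro Least_equality) (auto dest: injD)
  ultimately show ?thesis by (intro exI[of _ "\<lambda>m. Option.bind (?s m) \<psi>"]) auto
qed

section \<open>Binary strings and machines\<close>

text \<open>Naming strings by pairs of numbers reduces string-valued functions to arithmetic. Digits
  of \<open>v\<close> beyond the lowest \<open>n\<close> are dropped.\<close>

primrec bits :: "nat \<Rightarrow> nat \<Rightarrow> bool list" where
  "bits v 0 = []"
| "bits v (Suc n) = odd (v div 2 ^ n) # bits v n"

lemma length_bits [simp]: "length (bits v n) = n"
  by (induction n) auto

lemma bits_snoc: "bits v (Suc n) = bits (v div 2) n @ [odd v]"
proof (induction n)
  case (Suc n)
  have "v div 2 ^ Suc n = v div 2 div 2 ^ n"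
    by (simp add: div_mult2_eq)
  then show ?case using Suc by simp
qed simp

lemma bits_append: "w < 2 ^ l \<Longrightarrow> bits v n @ bits w l = bits (v * 2 ^ l + w) (n + l)"
proof (induction l arbitrary: w)
  case (Suc l)
  have "w div 2 < 2 ^ l" using Suc.prems by auto
  moreover have "(v * 2 ^ Suc l + w) div 2 = v * 2 ^ l + w div 2" by auto
  moreover have "odd (v * 2 ^ Suc l + w) = odd w" by simp
  ultimately show ?case
    using Suc.IH[of "w div 2"] bits_snoc[of w l] bits_snoc[of "v * 2 ^ Suc l + w" "n + l"] by simp
qed auto

lemma bits_surj: "\<exists>v. \<sigma> = bits v (length \<sigma>)"
proof (induction \<sigma> rule: rev_induct)
  case (snoc b \<sigma>)
  then obtain v where v: "\<sigma> = bits v (length \<sigma>)" by blast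
  have "\<sigma> @ [b] = bits (2 * v + of_bool b) (Suc (length \<sigma>))"
    using v by (simp add: bits_snoc del: bits.simps)
  then show ?case by auto
qed auto

lemma bits_inj: "bits v n = bits w n \<Longrightarrow> v < 2 ^ n \<Longrightarrow> w < 2 ^ n \<Longrightarrow> v = w"
proof (induction n arbitrary: v w)
  case (Suc n)
  have "v div 2 = w div 2" using Suc.prems by (intro Suc.IH) (auto simp: bits_snoc simp del: bits.simps)
  moreover have "odd v = odd w" using Suc.prems(1) by (simp add: bits_snoc del: bits.simps)
  ultimately show ?case by (metis div_mult_mod_eq odd_iff_mod_2_eq_one mod2_eq_if)
qed auto

lemma take_bits: "take n (bits w (n + l)) = bits (w div 2 ^ l) n"
proof (induction l arbitrary: w)
  case (Suc l)
  have "w div 2 div 2 ^ l = w div 2 ^ Suc l" by (simp add: div_mult2_eq)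
  then show ?case using Suc[of "w div 2"] bits_snoc[of w "n + l"] by simp
qed auto

text \<open>Self-delimiting markers become digit strings of the number 1, so
  \<open>bits_append\<close> can glue them to other words.\<close>

lemma bits_one: "bits 1 (Suc n) = replicate n False @ [True]"
proof (induction n)
  case (Suc n)
  have "bits 1 (Suc (Suc n)) = odd ((1::nat) div 2 ^ Suc n) # bits 1 (Suc n)" by (rule bits.simps)
  also have "(1::nat) div 2 ^ Suc n = 0" using one_less_power[of "2::nat" "Suc n"] by (intro div_less) simp
  finally show ?case using Suc by simp
qed simp

lemma prefix_replicate_False:
  "prefix (replicate k False @ True # \<sigma>) (replicate k' False @ True # \<tau>) \<longleftrightarrow> k = k' \<and> prefix \<sigma> \<tau>"
proof (induction k arbitrary: k')
  case 0
  then show ?case by (cases k') auto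
next
  case (Suc k)
  then show ?case by (cases k') auto
qed

section \<open>Codes of strings and simulation by a universal machine\<close>

lemma inj_string_code: "inj string_code"
proof (rule injI)
  fix \<sigma> \<tau> assume "string_code \<sigma> = string_code \<tau>"
  then have "map (of_bool :: bool \<Rightarrow> nat) \<sigma> = map of_bool \<tau>"
    unfolding string_code_def using injD[OF inj_list_encode] by blast
  moreover have "inj (of_bool :: bool \<Rightarrow> nat)" by (auto simp: inj_def)
  ultimately show "\<sigma> = \<tau>" using inj_map_eq_map by blast
qed

lemma tr_string_code_bits:
  assumes "total_recursive f" "total_recursive g"
  shows "total_recursive (\<lambda>n. string_code (bits (f n) (g n)))"
proof -
  have eq: "string_code (bits v n) =
      rec_nat 0 (\<lambda>m y. Suc (prod_encode ((v div 2 ^ m) mod 2, y))) n" for v n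
    by (induction n) (auto simp: string_code_def mod2_eq_if)
  show ?thesis unfolding eq
    by (intro tr_intros assms tr_comp[OF assms(1)])
qed

text \<open>Programs are indexed by numbers: the simulated machine searches for the \<open>z\<close>
  whose string is its input and diverges if there is none, so its domain inherits prefix-freeness
  from \<open>str\<close>.\<close>

lemma universal_machine_simulates:
  assumes "universal_machine U"
    and "total_recursive (\<lambda>z. string_code (str z))"
    and "\<And>z z'. prefix (str z) (str z') \<Longrightarrow> z = z'"
    and "partial_recursive (\<lambda>z. map_option string_code (out z))"
  shows "\<exists>\<rho>. \<forall>z. U (\<rho> @ str z) = out z"
proof -
  have "inj (\<lambda>z. string_code (str z))"
    using inj_string_code assms(3) by (metis (mono_tags, lifting) injD injI prefix_order.refl)
  then obtain \<phi> where \<phi>: "partial_recursive \<phi>"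
    "\<And>z. \<phi> (string_code (str z)) = map_option string_code (out z)"
    "\<And>m. m \<notin> range (\<lambda>z. string_code (str z)) \<Longrightarrow> \<phi> m = None"
    using partial_recursive_transport[OF assms(2) _ assms(4)] by blast
  define M where "M \<sigma> = map_option (inv string_code) (\<phi> (string_code \<sigma>))" for \<sigma>
  have M: "M (str z) = out z" for z
    by (simp add: M_def \<phi>(2) option.map_comp comp_def inv_f_f[OF inj_string_code] option.map_ident)
  have dom: "\<exists>z. \<sigma> = str z" if "\<sigma> \<in> dom M" for \<sigma>
  proof (rule ccontr)
    assume "\<nexists>z. \<sigma> = str z"
    then have "string_code \<sigma> \<notin> range (\<lambda>z. string_code (str z))"
      using injD[OF inj_string_code] by blast
    then show False using that \<phi>(3) by (auto simp: M_def)
  qed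
  have "\<phi> (string_code \<sigma>) = map_option string_code (M \<sigma>)" for \<sigma>
  proof (cases "\<exists>z. \<sigma> = str z")
    case True
    then show ?thesis using M \<phi>(2) by auto
  next
    case False
    then have "string_code \<sigma> \<notin> range (\<lambda>z. string_code (str z))"
      using injD[OF inj_string_code] by blast
    then show ?thesis by (simp add: M_def \<phi>(3))
  qed
  moreover have "\<forall>\<sigma>\<in>dom M. \<forall>\<tau>\<in>dom M. prefix \<sigma> \<tau> \<longrightarrow> \<sigma> = \<tau>"
    using dom assms(3) by metis
  ultimately have "prefix_free_machine M"
    unfolding prefix_free_machine_def using \<phi>(1) by blast
  then obtain \<rho> where "\<forall>\<tau>. U (\<rho> @ \<tau>) = M \<tau>"
    using assms(1) unfolding universal_machine_def by blast
  then show ?thesis using M by (intro exI[of _ \<rho>]) simp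
qed

lemma odd_part_unique:
  fixes x y :: nat
  shows "2 ^ r * (2 * x + 1) = 2 ^ s * (2 * y + 1) \<Longrightarrow> r = s \<and> x = y"
proof (induction r arbitrary: s)
  case 0
  from arg_cong[OF 0, of even] have "s = 0" by simp
  then show ?case using 0 by simp
next
  case (Suc r)
  from arg_cong[OF Suc.prems, of even] have "s \<noteq> 0" by simp
  then obtain s' where s: "s = Suc s'" using not0_implies_Suc by blast
  have "2 ^ r * (2 * x + 1) = 2 ^ s' * (2 * y + 1)" using Suc.prems unfolding s by simp
  from Suc.IH[OF this] show ?case using s by simp
qed

text \<open>
  A universal prefix-free machine takes the place of an enumeration theorem: \<open>\<theta>\<close> is coded by the
  prefix-free machine sending \<open>0\<^sup>x1\<close> to \<open>0\<close> repeated \<open>\<theta> x\<close> times, and the argument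
  \<open>2\<^sup>r (2x + 1)\<close> of the linearly universal function names a simulation prefix by \<open>r\<close>.
\<close>

lemma linearly_universal_exists:
  assumes "universal_machine U"
  shows "\<exists>\<psi>. linearly_universal \<psi>"
proof -
  obtain u where u: "partial_recursive u" "\<And>\<sigma>. u (string_code \<sigma>) = map_option string_code (U \<sigma>)"
    using assms unfolding universal_machine_def prefix_free_machine_def by blast
  have "total_recursive (\<lambda>y. string_code (bits 0 y))"
    by (intro tr_string_code_bits tr_intros)
  moreover have inj0: "inj (\<lambda>y. string_code (bits 0 y))"
    using inj_string_code by (metis (mono_tags, lifting) injD injI length_bits)
  ultimately obtain dec where dec: "partial_recursive dec" "\<And>y. dec (string_code (bits 0 y)) = Some y"
    using partial_recursive_transport[OF _ _ pr_total[OF tr_id]] by blast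
  \<comment> \<open>Here \<open>z\<close> holds a prefix, given by its number and length, together
    with \<open>x\<close>; the string coded is that prefix followed by the marker for
    \<open>x\<close>.\<close>
  define arg where "arg z = string_code (bits (pfst (pfst z) * 2 ^ Suc (psnd z) + 1)
      (psnd (pfst z) + Suc (psnd z)))" for z
  define w where "w z = 2 ^ pfst z * (2 * psnd z + 1)" for z
  have "partial_recursive (\<lambda>z. Option.bind (u (arg z)) dec)"
    unfolding arg_def
    by (intro pr_comp dec(1) pr_comp_total[OF u(1)] tr_string_code_bits tr_intros)
  moreover have "total_recursive w" unfolding w_def by (intro tr_intros)
  moreover have "inj w"
    unfolding w_def by (rule injI) (metis odd_part_unique prod.collapse prod_decode_inverse)
  ultimately obtain \<psi> where \<psi>: "partial_recursive \<psi>" "\<And>z. \<psi> (w z) = Option.bind (u (arg z)) dec"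
    using partial_recursive_transport by blast
  have "\<exists>a b. \<forall>x. \<psi> (a * x + b) = \<theta> x" if \<theta>: "partial_recursive \<theta>" for \<theta>
  proof -
    have "\<exists>\<rho>. \<forall>x. U (\<rho> @ bits 1 (Suc x)) = map_option (bits 0) (\<theta> x)"
    proof (rule universal_machine_simulates[OF assms])
      show "total_recursive (\<lambda>x. string_code (bits 1 (Suc x)))"
        by (intro tr_string_code_bits tr_intros)
      show "x = x'" if "prefix (bits 1 (Suc x)) (bits 1 (Suc x'))" for x x'
        using that unfolding bits_one prefix_replicate_False by simp
      show "partial_recursive (\<lambda>x. map_option string_code (map_option (bits 0) (\<theta> x)))"
        unfolding option.map_comp comp_def
        by (intro pr_map \<theta> tr_string_code_bits tr_intros)
    qed
    then obtain \<rho> where \<rho>: "\<And>x. U (\<rho> @ bits 1 (Suc x)) = map_option (bits 0) (\<theta> x)" by blast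
    obtain v where v: "\<rho> = bits v (length \<rho>)" using bits_surj by blast
    define r where "r = prod_encode (v, length \<rho>)"
    \<comment> \<open>For fixed \<open>r\<close> the argument 2^r (2x + 1) is linear in
      \<open>x\<close>.\<close>
    have "\<psi> (2 ^ Suc r * x + 2 ^ r) = \<theta> x" for x
    proof -
      have "arg (prod_encode (r, x)) = string_code (bits v (length \<rho>) @ bits 1 (Suc x))"
        using bits_append[OF one_less_power[of 2 "Suc x"]] by (simp add: arg_def r_def del: bits.simps power_Suc)
      also have "\<dots> = string_code (\<rho> @ bits 1 (Suc x))" using v by simp
      finally have "u (arg (prod_encode (r, x))) = map_option (\<lambda>y. string_code (bits 0 y)) (\<theta> x)"
        by (simp only: u(2) \<rho> option.map_comp comp_def)
      moreover have "2 ^ Suc r * x + 2 ^ r = w (prod_encode (r, x))"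
        by (simp add: w_def algebra_simps)
      ultimately show ?thesis by (cases "\<theta> x") (auto simp: \<psi>(2) dec(2))
    qed
    then show ?thesis by blast
  qed
  then show ?thesis using \<psi>(1) unfolding linearly_universal_def by blast
qed

section \<open>Fixed-point approximations of recursive reals\<close>

lemma rational_of_code_pos: "rational_of_code (prod_encode (2 * m, d)) = real m / real (Suc d)"
  by (simp add: rational_of_code_def int_decode_def sum_decode_def)

text \<open>Working with \<open>M n\<close> extra binary digits absorbs an error of
  \<open>M n\<close> units, because \<open>M n\<close> is at most \<open>2 ^ M n\<close>. The factor
  2 in the code selects nonnegative integers.\<close>

lemma recursive_real_functionI:
  assumes "total_recursive (\<lambda>z. Q (pfst z) (psnd z))" "total_recursive M"
    and "\<And>n k. \<bar>g n - real (Q n k) / 2 ^ k\<bar> \<le> real (M n) / 2 ^ k"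
  shows "recursive_real_function g"
proof -
  let ?K = "\<lambda>z. psnd z + M (pfst z)"
  let ?\<phi> = "\<lambda>z. prod_encode (2 * Q (pfst z) (?K z), 2 ^ ?K z - 1)"
  have "total_recursive (\<lambda>z. Q (pfst z) (?K z))"
    using tr_comp[OF assms(1), of "\<lambda>z. prod_encode (pfst z, ?K z)"]
    by (simp add: tr_intros tr_comp[OF assms(2)])
  then have "total_recursive ?\<phi>"
    by (intro tr_intros tr_comp[OF assms(2)])
  moreover have "\<bar>g n - rational_of_code (?\<phi> (prod_encode (n, k)))\<bar> \<le> 1 / 2 ^ k" for n k
  proof -
    have "real (M n) \<le> 2 ^ M n"
      using less_exp[of "M n"] by (metis less_imp_le of_nat_le_iff of_nat_numeral of_nat_power)
    then have "real (M n) / 2 ^ (k + M n) \<le> 1 / 2 ^ k"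
      by (simp add: power_add field_simps)
    with assms(3)[of n "k + M n"] show ?thesis
      by (simp add: rational_of_code_pos of_nat_diff)
  qed
  ultimately show ?thesis
    unfolding recursive_real_function_def by blast
qed

lemma real_div_nat_bounds:
  "real (a div b) \<le> real a / real b" "real a / real b < real (a div b) + 1"
proof -
  have "\<lfloor>real a / real b\<rfloor> = int (a div b)" by (rule floor_divide_of_nat_eq)
  then show "real (a div b) \<le> real a / real b" "real a / real b < real (a div b) + 1"
    using floor_correct[of "real a / real b"] by simp_all
qed

text \<open>One unit of error comes from the given rational and one from rounding down. A negative
  rational, which has an odd code, is replaced by 0; this is no farther from the nonnegative
  \<open>g n\<close>.\<close>

lemma recursive_real_functionE:
  assumes "recursive_real_function g" "\<And>n. 0 \<le> g n"
  shows "\<exists>Q. total_recursive (\<lambda>z. Q (pfst z) (psnd z)) \<and>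
    (\<forall>n k. \<bar>g n - real (Q n k) / 2 ^ k\<bar> \<le> 2 / 2 ^ k)"
proof -
  obtain \<phi> where \<phi>: "total_recursive \<phi>"
    "\<And>n k. \<bar>g n - rational_of_code (\<phi> (prod_encode (n, k)))\<bar> \<le> 1 / 2 ^ k"
    using assms(1) unfolding recursive_real_function_def by blast
  let ?Q = "\<lambda>n k. let c = \<phi> (prod_encode (n, k)); s = pfst c in
     if s mod 2 = 0 then 2 ^ k * (s div 2) div Suc (psnd c) else 0"
  have "total_recursive (\<lambda>z. ?Q (pfst z) (psnd z))"
    unfolding Let_def by (intro tr_intros tr_comp[OF \<phi>(1)])
  moreover have "\<bar>g n - real (?Q n k) / 2 ^ k\<bar> \<le> 2 / 2 ^ k" for n k
  proof -
    define c where "c = \<phi> (prod_encode (n, k))"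
    define s where "s = pfst c"
    have c: "rational_of_code c = real_of_int (int_decode s) / real (Suc (psnd c))"
      by (simp add: rational_of_code_def s_def Let_def split: prod.split)
    have near: "\<bar>g n - rational_of_code c\<bar> \<le> 1 / 2 ^ k" using \<phi>(2) unfolding c_def .
    show ?thesis
    proof (cases "even s")
      case True
      then obtain t where t: "s = 2 * t" by blast
      define D where "D = real (Suc (psnd c))"
      have D: "D > 0" unfolding D_def by simp
      have Q: "?Q n k = 2 ^ k * t div Suc (psnd c)"
        unfolding c_def[symmetric] Let_def s_def[symmetric] t by simp
      have r: "rational_of_code c = real t / D"
        unfolding c t D_def by (simp add: int_decode_def sum_decode_def)
      have "real (?Q n k) \<le> 2 ^ k * (real t / D)" "2 ^ k * (real t / D) < real (?Q n k) + 1"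
        using real_div_nat_bounds[of "2 ^ k * t" "Suc (psnd c)"] unfolding Q D_def by simp_all
      then have "real (?Q n k) / 2 ^ k \<le> rational_of_code c"
        "rational_of_code c \<le> real (?Q n k) / 2 ^ k + 1 / 2 ^ k"
        unfolding r by (simp_all add: field_simps)
      moreover have "2 / 2 ^ k = 1 / 2 ^ k + 1 / (2 ^ k :: real)" by simp
      ultimately show ?thesis using near by linarith
    next
      case False
      then have "int_decode s < 0" by (auto simp: int_decode_def sum_decode_def)
      then have "rational_of_code c \<le> 0" unfolding c by (simp add: divide_nonpos_pos)
      moreover have "?Q n k = 0"
        using False unfolding c_def[symmetric] Let_def s_def[symmetric] by (simp add: mod2_eq_if)
      ultimately show ?thesis using near assms(2)[of n] by (simp add: abs_le_iff)
    qed
  qed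
  ultimately show ?thesis by (intro exI[of _ ?Q]) blast
qed

lemma recursive_real_iff: "recursive_real x \<longleftrightarrow> recursive_real_function (\<lambda>_. x)"
proof
  assume "recursive_real x"
  then obtain \<phi> where "total_recursive \<phi>" "\<And>k. \<bar>x - rational_of_code (\<phi> k)\<bar> \<le> 1 / 2 ^ k"
    unfolding recursive_real_def by blast
  then show "recursive_real_function (\<lambda>_. x)"
    unfolding recursive_real_function_def
    by (intro exI[of _ "\<lambda>z. \<phi> (psnd z)"]) (auto intro!: tr_comp[of \<phi>] tr_intros)
next
  assume "recursive_real_function (\<lambda>_. x)"
  then obtain \<phi> where "total_recursive \<phi>"
    "\<And>n k. \<bar>x - rational_of_code (\<phi> (prod_encode (n, k)))\<bar> \<le> 1 / 2 ^ k"
    unfolding recursive_real_function_def by blast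
  then show "recursive_real x"
    unfolding recursive_real_def
    by (intro exI[of _ "\<lambda>k. \<phi> (prod_encode (0, k))"]) (auto intro!: tr_comp[of \<phi>] tr_intros)
qed

lemma inverse_approx:
  assumes "recursive_real_function g" "\<And>n. 1 < g n"
  shows "\<exists>J. total_recursive (\<lambda>z. J (pfst z) (psnd z)) \<and>
    (\<forall>n k. \<bar>inverse (g n) - real (J n k) / 2 ^ k\<bar> \<le> 2 / 2 ^ k)"
proof -
  obtain Q where Q: "total_recursive (\<lambda>z. Q (pfst z) (psnd z))"
    "\<And>n k. \<bar>g n - real (Q n k) / 2 ^ k\<bar> \<le> 2 / 2 ^ k"
    using recursive_real_functionE[OF assms(1)] assms(2) by (meson less_imp_le less_trans zero_less_one)
  \<comment> \<open>Two extra digits keep the approximation of \<open>g n\<close> at least 1/2, so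
    inversion at most doubles its error.\<close>
  let ?J = "\<lambda>n k. (2 ^ k * 2 ^ (k + 2)) div Q n (k + 2)"
  have "total_recursive (\<lambda>z. Q (pfst z) (psnd z + 2))"
    using tr_comp[OF Q(1), of "\<lambda>z. prod_encode (pfst z, psnd z + 2)"] by (simp add: tr_intros)
  then have "total_recursive (\<lambda>z. ?J (pfst z) (psnd z))"
    by (intro tr_intros)
  moreover have "\<bar>inverse (g n) - real (?J n k) / 2 ^ k\<bar> \<le> 2 / 2 ^ k" for n k
  proof -
    define y where "y = real (Q n (k + 2)) / 2 ^ (k + 2)"
    have near: "\<bar>g n - y\<bar> \<le> 1 / 2 / 2 ^ k"
      using Q(2)[of n "k + 2"] by (simp add: y_def)
    moreover have "1 / 2 / 2 ^ k \<le> (1 / 2 :: real)"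
      by (simp add: field_simps)
    ultimately have y: "1 / 2 \<le> y" using assms(2)[of n] by linarith
    have "real (2 ^ k * 2 ^ (k + 2)) / real (Q n (k + 2)) = 2 ^ k * inverse y"
      by (simp add: y_def field_simps)
    then have "real (?J n k) \<le> 2 ^ k * inverse y" "2 ^ k * inverse y < real (?J n k) + 1"
      using real_div_nat_bounds[where a = "2 ^ k * 2 ^ (k + 2)" and b = "Q n (k + 2)"] by simp_all
    then have J: "real (?J n k) / 2 ^ k \<le> inverse y" "inverse y \<le> real (?J n k) / 2 ^ k + 1 / 2 ^ k"
      by (simp_all add: field_simps)
    have "inverse (g n) - inverse y = (y - g n) / (g n * y)"
      using assms(2)[of n] y by (simp add: field_simps)
    then have "\<bar>inverse (g n) - inverse y\<bar> = \<bar>g n - y\<bar> / (g n * y)"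
      using assms(2)[of n] y by (simp add: abs_mult abs_minus_commute)
    also have "\<dots> \<le> (1 / 2 / 2 ^ k) / (1 * (1 / 2))"
      using near assms(2)[of n] y by (intro frac_le mult_mono) auto
    finally have "\<bar>inverse (g n) - inverse y\<bar> \<le> 1 / 2 ^ k" by simp
    moreover have "2 / 2 ^ k = 1 / 2 ^ k + 1 / (2 ^ k :: real)" by simp
    ultimately show ?thesis using J by linarith
  qed
  ultimately show ?thesis by (intro exI[of _ ?J]) blast
qed

text \<open>The counter waits for a certificate of its next value. Certificates must hold
  eventually, not just once, because the counter may be late in reaching a value.\<close>

lemma stepwise_counter:
  assumes cert: "decidable (\<lambda>z. cert (pfst z) (psnd z))"
    and ev: "\<And>k. \<forall>\<^sub>F n in sequentially. cert n k"
  shows "\<exists>\<kappa>. total_recursive \<kappa> \<and> mono \<kappa> \<and> \<kappa> 0 = 0 \<and> (\<forall>n. \<kappa> (Suc n) \<le> Suc (\<kappa> n)) \<and>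
    (\<forall>n. \<kappa> n \<noteq> 0 \<longrightarrow> (\<exists>i\<le>n. cert i (\<kappa> n))) \<and> (\<forall>b. \<exists>n. b \<le> \<kappa> n)"
proof -
  define \<kappa> where "\<kappa> = rec_nat 0 (\<lambda>m y. if cert (Suc m) (Suc y) then Suc y else y)"
  have \<kappa>0: "\<kappa> 0 = 0"
    and \<kappa>Suc: "\<kappa> (Suc n) = (if cert (Suc n) (Suc (\<kappa> n)) then Suc (\<kappa> n) else \<kappa> n)" for n
    by (simp_all add: \<kappa>_def)
  have "total_recursive (\<lambda>n. rec_nat 0 (\<lambda>m y. if cert (Suc m) (Suc y) then Suc y else y) n)"
  proof (intro tr_rec tr_if tr_Suc tr_snd tr_id tr_const)
    show "decidable (\<lambda>z. cert (Suc (pfst (psnd z))) (Suc (psnd (psnd z))))"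
      using tr_comp[OF cert[unfolded decidable_def], of "\<lambda>z. prod_encode (Suc (pfst (psnd z)), Suc (psnd (psnd z)))"]
      by (simp add: tr_intros decidable_def)
  qed
  then have tr: "total_recursive \<kappa>" by (simp add: \<kappa>_def)
  have "mono \<kappa>" by (rule incseq_SucI) (simp add: \<kappa>Suc)
  moreover have "\<kappa> (Suc n) \<le> Suc (\<kappa> n)" for n by (simp add: \<kappa>Suc)
  moreover have "\<kappa> n \<noteq> 0 \<longrightarrow> (\<exists>i\<le>n. cert i (\<kappa> n))" for n
    by (induction n) (auto simp: \<kappa>0 \<kappa>Suc le_Suc_eq)
  moreover have "\<exists>n. b \<le> \<kappa> n" for b
  proof (induction b)
    case (Suc b)
    then obtain n where n: "b \<le> \<kappa> n" by blast
    obtain N where N: "\<And>m. m \<ge> N \<Longrightarrow> cert m (Suc b)"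
      using ev[of "Suc b"] unfolding eventually_sequentially by blast
    define m where "m = max n N"
    have "b \<le> \<kappa> m" using n monoD[OF \<open>mono \<kappa>\<close>, of n m] by (simp add: m_def)
    then have "Suc b \<le> \<kappa> (Suc m)"
      using N[of "Suc m"] by (cases "b = \<kappa> m") (auto simp: \<kappa>Suc m_def)
    then show ?case by blast
  qed auto
  ultimately show ?thesis using tr \<kappa>0 by blast
qed

section \<open>The complexity bound\<close>

text \<open>Approximations at precision 0 are off by at most 2. Where subtracting 2 truncates,
  positivity of \<open>p\<close> gives the lower bound.\<close>

lemma order_function_bounds:
  assumes "order_function p" "\<And>n. 1 < p n"
  shows "\<exists>A B. total_recursive A \<and> total_recursive B \<and>
    (\<forall>n. real (A n) \<le> p n \<and> p n \<le> real (A n) + 4 \<and> p n \<le> real (B n) \<and> real (B n) \<le> p n + 4)"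
proof -
  have "0 \<le> p n" for n using assms(2)[of n] by simp
  then obtain Q where Q: "total_recursive (\<lambda>z. Q (pfst z) (psnd z))"
    "\<And>n k. \<bar>p n - real (Q n k) / 2 ^ k\<bar> \<le> 2 / 2 ^ k"
    using recursive_real_functionE assms(1) unfolding order_function_def by blast
  have tr: "total_recursive (\<lambda>n. Q n 0)"
    using tr_comp[OF Q(1), of "\<lambda>n. prod_encode (n, 0)"] by (simp add: tr_intros)
  have "real (Q n 0 - 2) \<le> p n \<and> p n \<le> real (Q n 0 - 2) + 4 \<and>
      p n \<le> real (Q n 0 + 2) \<and> real (Q n 0 + 2) \<le> p n + 4" for n
    using Q(2)[of n 0] assms(2)[of n] by (cases "2 \<le> Q n 0") (auto simp: of_nat_diff abs_le_iff)
  then show ?thesis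
    using tr by (intro exI[of _ "\<lambda>n. Q n 0 - 2"] exI[of _ "\<lambda>n. Q n 0 + 2"]) (auto intro!: tr_intros)
qed

text \<open>The witness is the last argument at which \<open>p\<close> is below the threshold. It
  exists because \<open>m\<close> is such an argument, which also puts \<open>n\<close> outside the
  default range of \<open>complexity_bound\<close>.\<close>

lemma complexity_bound_eq:
  assumes "order_function p" "p m < 2 ^ (n + 1)"
  shows "\<exists>M\<ge>m. p M < 2 ^ (n + 1) \<and> complexity_bound p q n = log 2 (q M)"
proof -
  let ?k = "pinv p (2 ^ (n + 1))"
  have "mono p" and "\<exists>m. 2 ^ (n + 1) \<le> p m"
    using assms(1) unfolding order_function_def by (auto intro: less_imp_le)
  then have k: "2 ^ (n + 1) \<le> p ?k"
    unfolding pinv_def using LeastI_ex[of "\<lambda>m. 2 ^ (n + 1) \<le> p m"] by simp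
  have "m < ?k"
    using k assms(2) monoD[OF \<open>mono p\<close>, of ?k m] by (meson leD leI order_trans)
  moreover have "p (?k - 1) < 2 ^ (n + 1)"
    using \<open>m < ?k\<close> not_less_Least[of "?k - 1" "\<lambda>m. 2 ^ (n + 1) \<le> p m"]
    unfolding pinv_def by (auto simp: not_le)
  moreover have "max (LEAST a. 0 < pinv p (2 ^ (a + 1))) n = n"
    using \<open>m < ?k\<close> by (intro max_absorb2 Least_le) auto
  then have "complexity_bound p q n = log 2 (q (?k - 1))"
    unfolding complexity_bound_def Let_def by simp
  ultimately show ?thesis by (intro exI[of _ "?k - 1"]) auto
qed

lemma complexity_bound_dominated:
  assumes p: "order_function p" "\<And>n. 1 < p n" and "summable_companion p q"
  shows "\<exists>g. convex_order g \<and> sub_identical g \<and> recursive_real_function g \<and>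
    dominated_by (complexity_bound p q) g"
proof -
  have q: "order_function q" "\<And>n. 1 < q n"
    and ratio: "mono (\<lambda>n. p n / q n)" "filterlim (\<lambda>n. p n / q n) at_top sequentially"
    using assms(3) unfolding summable_companion_def increases_to_infinity_def by auto
  obtain A B where AB: "total_recursive A" "total_recursive B"
    "\<And>n. real (A n) \<le> p n" "\<And>n. p n \<le> real (A n) + 4" "\<And>n. p n \<le> real (B n)"
    using order_function_bounds[OF p] by blast
  obtain C where C: "total_recursive C" "\<And>n. q n \<le> real (C n)" "\<And>n. real (C n) \<le> q n + 4"
    using order_function_bounds[OF q] by blast
  \<comment> \<open>A certificate witnesses \<open>p m < 2 ^ (n + 1)\<close> and
    \<open>2 ^ (d + 1) <= p m / q m\<close>. The ratio is nondecreasing, so the latter passes to the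
    argument \<open>M\<close> in the complexity bound, whence
    \<open>q M < 2 ^ (n - d)\<close>.\<close>
  define cert where "cert n d \<longleftrightarrow> (\<exists>m\<le>n. B m < 2 ^ (n + 1) \<and> 2 ^ (d + 1) * C m \<le> A m)" for n d
  have "decidable (\<lambda>z. cert (pfst z) (psnd z))"
    unfolding cert_def
    by (intro tr_intros tr_comp[OF AB(1)] tr_comp[OF AB(2)] tr_comp[OF C(1)])
  moreover have "\<forall>\<^sub>F n in sequentially. cert n d" for d
  proof -
    \<comment> \<open>As \<open>q m > 1\<close>, the error 4 in \<open>C m\<close> gives at most
      \<open>5 * q m\<close>, and the error 4 in \<open>A m\<close> is less than
      \<open>4 * q m\<close>.\<close>
    obtain m where m: "5 * 2 ^ (d + 1) + 4 \<le> p m / q m"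
      using ratio(2) unfolding filterlim_at_top eventually_sequentially by blast
    have "(5 * 2 ^ (d + 1) + 4) * q m \<le> p m" using m q(2)[of m] by (simp add: field_simps)
    moreover have "real (C m) \<le> 5 * q m" using C(3)[of m] q(2)[of m] by simp
    then have "2 ^ (d + 1) * real (C m) \<le> 2 ^ (d + 1) * (5 * q m)" by (intro mult_left_mono) auto
    ultimately have "2 ^ (d + 1) * real (C m) \<le> real (A m)"
      using AB(4)[of m] q(2)[of m] unfolding distrib_right by linarith
    then have "real (2 ^ (d + 1) * C m) \<le> real (A m)" by simp
    then have A: "2 ^ (d + 1) * C m \<le> A m" unfolding of_nat_le_iff .
    have "cert n d" if "n \<ge> max m (B m)" for n
    proof -
      have "B m < 2 ^ (n + 1)" using that less_exp[of "n + 1"] by linarith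
      then show ?thesis using A that unfolding cert_def by auto
    qed
    then show ?thesis unfolding eventually_sequentially by blast
  qed
  ultimately obtain D where D: "total_recursive D" "mono D" "D 0 = 0" "\<And>n. D (Suc n) \<le> Suc (D n)"
    "\<And>n. D n \<noteq> 0 \<Longrightarrow> \<exists>i\<le>n. cert i (D n)" "\<And>b. \<exists>n. b \<le> D n"
    using stepwise_counter[of cert] by blast
  have Dn: "D n \<le> n" for n
  proof (induction n)
    case (Suc n)
    then show ?case using D(4)[of n] by linarith
  qed (simp add: D(3))
  \<comment> \<open>Steps of \<open>D\<close> are 0 or 1, so \<open>g\<close> never falls and rises
    by at most 1; \<open>Dn\<close> makes the subtraction exact.\<close>
  define g where "g n = real (n - D n)" for n
  have g: "g n = real n - real (D n)" for n using Dn[of n] by (simp add: g_def of_nat_diff)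
  have "g n \<le> g (Suc n)" "g (Suc n) - g n \<le> 1" for n
    using D(4)[of n] monoD[OF D(2), of n "Suc n"] by (auto simp: g)
  then have "convex_order g"
    unfolding convex_order_def by (auto intro: incseq_SucI)
  moreover have "filterlim (\<lambda>n. real (D n)) at_top sequentially"
    unfolding filterlim_at_top eventually_sequentially
  proof
    fix Z :: real
    obtain N where "nat \<lceil>Z\<rceil> \<le> D N" using D(6) by blast
    then have "Z \<le> real (D n)" if "n \<ge> N" for n
      using monoD[OF D(2) that] by linarith
    then show "\<exists>N. \<forall>n\<ge>N. Z \<le> real (D n)" by blast
  qed
  then have "sub_identical g"
    unfolding sub_identical_def by (simp add: g) (simp add: Dn)
  moreover have "recursive_real_function g"
  proof (rule recursive_real_functionI)
    show "total_recursive (\<lambda>z. 2 ^ psnd z * (pfst z - D (pfst z)))"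
      by (intro tr_intros tr_comp[OF D(1)])
    show "\<bar>g n - real (2 ^ k * (n - D n)) / 2 ^ k\<bar> \<le> real 0 / 2 ^ k" for n k
      by (simp add: g_def)
  qed (rule tr_const)
  moreover have "complexity_bound p q n \<le> g n" if n: "D n \<noteq> 0" for n
  proof -
    obtain i m where im: "i \<le> n" "B m < 2 ^ (i + 1)" "2 ^ (D n + 1) * C m \<le> A m"
      using D(5)[OF n] unfolding cert_def by blast
    have "(2::nat) ^ (i + 1) \<le> 2 ^ (n + 1)" using im(1) by (intro power_increasing) auto
    then have "real (B m) < real (2 ^ (n + 1))"
      using im(2) unfolding of_nat_less_iff by (rule order.strict_trans2[rotated])
    then have "p m < 2 ^ (n + 1)" using AB(5)[of m] by simp
    then obtain M where M: "m \<le> M" "p M < 2 ^ (n + 1)" "complexity_bound p q n = log 2 (q M)"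
      using complexity_bound_eq[OF p(1), where q = q] by blast
    have "2 ^ (D n + 1) * q m \<le> 2 ^ (D n + 1) * real (C m)" using C(2) by (intro mult_left_mono) auto
    also have "\<dots> = real (2 ^ (D n + 1) * C m)" by simp
    also have "\<dots> \<le> real (A m)" using im(3) unfolding of_nat_le_iff .
    also have "\<dots> \<le> p m" by (rule AB(3))
    finally have "2 ^ (D n + 1) \<le> p m / q m" using q(2)[of m] by (simp add: field_simps)
    also have "\<dots> \<le> p M / q M" using monoD[OF ratio(1) M(1)] .
    finally have "2 ^ (D n + 1) * q M \<le> p M" using q(2)[of M] by (simp add: field_simps)
    also have "\<dots> < 2 ^ (D n + 1) * 2 ^ (n - D n)"
      using M(2) Dn[of n] by (simp del: power_Suc flip: power_add)
    finally have "q M < 2 powr real (n - D n)" by (simp add: powr_realpow)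
    then show ?thesis using q(2)[of M] unfolding M(3) g_def by (subst log_le_iff) auto
  qed
  moreover have "\<forall>\<^sub>F n in sequentially. D n \<noteq> 0"
  proof -
    obtain N where "1 \<le> D N" using D(6) by blast
    then have "D n \<noteq> 0" if "n \<ge> N" for n using monoD[OF D(2) that] by simp
    then show ?thesis unfolding eventually_sequentially by blast
  qed
  ultimately show ?thesis
    unfolding dominated_by_def by (intro exI[of _ g]) (auto elim: eventually_mono)
qed

section \<open>Existence of a companion\<close>

lemma summable_inverse_unbounded:
  assumes "\<And>n. 0 < (q n :: real)" "summable (\<lambda>n. inverse (q n))"
  shows "\<exists>n. b < q n"
proof (rule ccontr)
  assume "\<nexists>n. b < q n"
  then have le: "q n \<le> b" for n by (simp add: not_less)
  have "0 < b" using le[of 0] assms(1)[of 0] by simp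
  have "(\<lambda>n. inverse (q n)) \<longlonglongrightarrow> 0" by (rule summable_LIMSEQ_zero[OF assms(2)])
  moreover have "inverse b \<le> inverse (q n)" for n using le assms(1) by (intro le_imp_inverse_le) auto
  ultimately have "inverse b \<le> 0" by (intro LIMSEQ_le_const) auto
  then show False using \<open>0 < b\<close> by simp
qed

text \<open>This is the error of the tail estimates in \<open>companion_exists\<close>. Up to the
  factor 4, its terms are those of a convergent series.\<close>

lemma nat_over_two_power_limit: "(\<lambda>n. (4 + 4 * real n) / 2 ^ n) \<longlonglongrightarrow> 0"
proof -
  have "summable (\<lambda>n. (1 + real n) * (1 / 2) ^ n)"
    using geometric_deriv_sums[of "1 / 2 :: real"] by (auto simp: sums_iff)
  then have "(\<lambda>n. 4 * ((1 + real n) * (1 / 2) ^ n)) \<longlonglongrightarrow> 4 * 0"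
    by (intro tendsto_mult_left summable_LIMSEQ_zero)
  then show ?thesis by (simp add: field_simps)
qed

text \<open>
  If the tail \<open>t\<close> of the series \<open>1 / p\<close> satisfies \<open>t n \<le> 4\<^sup>-\<^sup>\<kappa>\<^sup>n\<close>, then
  \<open>2\<^sup>\<kappa>\<^sup>n / p n \<le> (t n - t (n + 1)) / sqrt (t n)\<close>, which telescopes up to a factor of \<open>2\<close>.
\<close>

lemma tail_sum_bound:
  fixes p t :: "nat \<Rightarrow> real" and \<kappa> :: "nat \<Rightarrow> nat"
  assumes "\<And>n. inverse (p n) = t n - t (Suc n)" "\<And>n. 0 < t n" "\<And>n. t (Suc n) \<le> t n"
    and "\<And>n. N \<le> n \<Longrightarrow> t n \<le> 1 / 4 ^ \<kappa> n"
  shows "(\<Sum>i<m. 2 ^ \<kappa> (i + N) * inverse (p (i + N))) \<le> 2 / 2 ^ \<kappa> N"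
proof -
  have root: "2 ^ \<kappa> n * sqrt (t n) \<le> 1" if "N \<le> n" for n
  proof (rule power2_le_imp_le)
    have four: "(2::real) ^ \<kappa> n * 2 ^ \<kappa> n = 4 ^ \<kappa> n"
      by (simp flip: power_mult_distrib)
    have "(2 ^ \<kappa> n * sqrt (t n))\<^sup>2 = (2 ^ \<kappa> n * 2 ^ \<kappa> n) * (sqrt (t n))\<^sup>2"
      by (simp add: power2_eq_square)
    also have "\<dots> = 4 ^ \<kappa> n * t n" using assms(2)[of n] unfolding four by simp
    also have "\<dots> \<le> 1" using assms(4)[OF that] by (simp add: field_simps)
    finally show "(2 ^ \<kappa> n * sqrt (t n))\<^sup>2 \<le> 1\<^sup>2" by simp
  qed simp
  have step: "2 ^ \<kappa> n * inverse (p n) \<le> 2 * (sqrt (t n) - sqrt (t (Suc n)))" if "N \<le> n" for n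
  proof -
    let ?a = "sqrt (t n)" and ?b = "sqrt (t (Suc n))"
    have ab: "0 < ?a" "0 < ?b" "?b \<le> ?a" using assms(2,3) by auto
    have "t n - t (Suc n) = (?a - ?b) * (?a + ?b)"
      using assms(2)[of n] assms(2)[of "Suc n"] by (simp add: algebra_simps)
    \<comment> \<open>The factor 2 is lost here; the remaining \<open>?a\<close> is absorbed by
      \<open>2 ^ \<kappa> n\<close> through \<open>root\<close>.\<close>
    also have "\<dots> \<le> (?a - ?b) * (2 * ?a)" using ab by (intro mult_left_mono) auto
    finally have "2 ^ \<kappa> n * inverse (p n) \<le> 2 ^ \<kappa> n * ((?a - ?b) * (2 * ?a))"
      unfolding assms(1) by (intro mult_left_mono) auto
    also have "\<dots> = (2 ^ \<kappa> n * ?a) * (2 * (?a - ?b))" by (simp add: algebra_simps)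
    also have "\<dots> \<le> 1 * (2 * (?a - ?b))" using root[OF that] ab by (intro mult_right_mono) auto
    finally show ?thesis by simp
  qed
  have "(\<Sum>i<m. 2 ^ \<kappa> (i + N) * inverse (p (i + N))) \<le>
      (\<Sum>i<m. 2 * sqrt (t (i + N)) - 2 * sqrt (t (Suc i + N)))"
    using step[OF le_add2] by (intro sum_mono) (simp add: algebra_simps)
  also have "\<dots> = 2 * sqrt (t N) - 2 * sqrt (t (m + N))"
    using sum_lessThan_telescope'[of "\<lambda>i. 2 * sqrt (t (i + N))" m] by simp
  also have "\<dots> \<le> 2 * sqrt (t N)" using assms(2)[of "m + N"] by simp
  also have "\<dots> \<le> 2 / 2 ^ \<kappa> N" using root[of N] by (simp add: field_simps)
  finally show ?thesis .
qed

text \<open>Searching for \<open>\<kappa> n >= k + 1\<close> makes the tail at most 2^-k. The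
  \<open>N k\<close> terms before it are computed with \<open>N k\<close> extra digits, so their
  errors total at most 2 units of 2^-k; the final rounding costs one more.\<close>

lemma recursive_real_suminf_inverse:
  assumes q: "recursive_real_function q" "\<And>n. 1 < q n" and "total_recursive \<kappa>" "\<And>b. \<exists>n. b \<le> \<kappa> n"
    and tail: "\<And>n m. \<kappa> n \<noteq> 0 \<Longrightarrow> (\<Sum>i<m. inverse (q (i + n))) \<le> 2 / 2 ^ \<kappa> n"
  shows "summable (\<lambda>n. inverse (q n)) \<and> recursive_real (\<Sum>n. inverse (q n))"
proof -
  have pos: "0 < inverse (q n)" for n using q(2)[of n] by simp
  have summ: "summable (\<lambda>i. inverse (q (i + n)))" if "\<kappa> n \<noteq> 0" for n
    using tail[OF that] pos by (intro summableI_nonneg_bounded) (auto intro: less_imp_le)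
  obtain n where "1 \<le> \<kappa> n" using assms(4) by blast
  then have summable: "summable (\<lambda>n. inverse (q n))"
    using summ[of n] summable_iff_shift[of "\<lambda>n. inverse (q n)" n] by simp
  obtain J where J: "total_recursive (\<lambda>z. J (pfst z) (psnd z))"
    "\<And>n k. \<bar>inverse (q n) - real (J n k) / 2 ^ k\<bar> \<le> 2 / 2 ^ k"
    using inverse_approx[OF q] by blast
  define N where "N k = (LEAST n. Suc k \<le> \<kappa> n)" for k
  have trN: "total_recursive N"
    unfolding N_def by (rule tr_Least) (intro tr_intros tr_comp[OF assms(3)] assms(4))+
  have N: "Suc k \<le> \<kappa> (N k)" for k unfolding N_def by (rule LeastI_ex) (rule assms(4))
  define Q where "Q k = (\<Sum>i<N k. J i (k + N k)) div 2 ^ N k" for k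
  have J': "total_recursive (\<lambda>z. J (psnd z) (psnd (pfst z) + N (psnd (pfst z))))"
    using tr_comp[OF J(1), of "\<lambda>z. prod_encode (psnd z, psnd (pfst z) + N (psnd (pfst z)))"]
    by (simp add: tr_intros tr_comp[OF trN])
  have "recursive_real_function (\<lambda>_. \<Sum>n. inverse (q n))"
  proof (rule recursive_real_functionI)
    show "total_recursive (\<lambda>z. Q (psnd z))"
      unfolding Q_def by (intro tr_intros tr_comp[OF trN] J')
    show "\<bar>(\<Sum>n. inverse (q n)) - real (Q k) / 2 ^ k\<bar> \<le> real 4 / 2 ^ k" for k
    proof -
      let ?n = "N k" and ?K = "k + N k"
      have n0: "\<kappa> ?n \<noteq> 0" using N[of k] by simp
      define s where "s = (\<Sum>i<?n. real (J i ?K)) / 2 ^ ?K"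
      have "(\<Sum>n. inverse (q n)) = (\<Sum>i. inverse (q (i + ?n))) + (\<Sum>i<?n. inverse (q i))"
        by (rule suminf_split_initial_segment[OF summable])
      moreover have "(\<Sum>i. inverse (q (i + ?n))) \<le> 2 / 2 ^ \<kappa> ?n"
        using tail[OF n0] by (intro suminf_le_const summ[OF n0])
      moreover have "2 / 2 ^ \<kappa> ?n \<le> 1 / (2 ^ k :: real)"
        using power_increasing[OF N[of k], of "2::real"] by (simp add: field_simps)
      moreover have "0 \<le> (\<Sum>i. inverse (q (i + ?n)))"
        using pos by (intro suminf_nonneg summ[OF n0]) (auto intro: less_imp_le)
      ultimately have 1: "\<bar>(\<Sum>n. inverse (q n)) - (\<Sum>i<?n. inverse (q i))\<bar> \<le> 1 / 2 ^ k" by simp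
      have "\<bar>(\<Sum>i<?n. inverse (q i)) - s\<bar> = \<bar>\<Sum>i<?n. (inverse (q i) - real (J i ?K) / 2 ^ ?K)\<bar>"
        unfolding s_def by (simp add: sum_subtractf sum_divide_distrib)
      also have "\<dots> \<le> (\<Sum>i<?n. \<bar>inverse (q i) - real (J i ?K) / 2 ^ ?K\<bar>)" by (rule sum_abs)
      also have "\<dots> \<le> (\<Sum>i<?n. 2 / 2 ^ ?K)" by (intro sum_mono J(2))
      also have "\<dots> = (real ?n / 2 ^ ?n) * (2 / 2 ^ k)" by (simp add: power_add)
      also have "\<dots> \<le> 1 * (2 / 2 ^ k)"
      proof (rule mult_right_mono)
        have "real ?n \<le> 2 ^ ?n"
          using less_exp[of ?n] by (metis less_imp_le of_nat_le_iff of_nat_numeral of_nat_power)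
        then show "real ?n / 2 ^ ?n \<le> 1" by simp
      qed simp
      finally have 2: "\<bar>(\<Sum>i<?n. inverse (q i)) - s\<bar> \<le> 2 / 2 ^ k" by simp
      have "2 ^ k * s = real (\<Sum>i<?n. J i ?K) / real (2 ^ ?n)"
        unfolding s_def by (simp add: power_add)
      then have "real (Q k) \<le> 2 ^ k * s" "2 ^ k * s < real (Q k) + 1"
        unfolding Q_def by (metis real_div_nat_bounds)+
      then have "real (Q k) / 2 ^ k \<le> s" "s \<le> real (Q k) / 2 ^ k + 1 / 2 ^ k"
        by (simp_all add: field_simps)
      then have "\<bar>s - real (Q k) / 2 ^ k\<bar> \<le> 1 / 2 ^ k" by simp
      moreover have "1 / 2 ^ k + 2 / 2 ^ k + 1 / 2 ^ k = real 4 / 2 ^ k" by simp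
      ultimately show ?thesis using 1 2 by linarith
    qed
  qed (rule tr_const)
  then show ?thesis using summable unfolding recursive_real_iff by blast
qed

lemma tr_max:
  assumes "total_recursive f" "total_recursive g"
  shows "total_recursive (\<lambda>n. max (f n) (g n))"
  unfolding max_def by (intro tr_intros assms)

text \<open>
  With \<open>\<kappa>\<close> slowly increasing to infinity, the running maximum \<open>q\<close> of \<open>p / 2\<^sup>\<kappa>\<close> is nondecreasing, and
  \<open>p / q\<close> is the running minimum over \<open>i \<le> n\<close> of \<open>2\<^sup>\<kappa>\<^sup>i p n / p i\<close>. It is nondecreasing too, since the new
  term \<open>2\<^sup>\<kappa>\<^sup>n\<close> at \<open>i = n\<close> is at least the old term at \<open>i = n - 1\<close>.
\<close>

lemma companion_exists:
  assumes p: "fast_growing p" and rec: "recursive_real (\<Sum>n. inverse (p n))"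
  shows "\<exists>q. summable_companion p q"
proof -
  have p_rec: "recursive_real_function p" and "mono p" and p1: "\<And>n. 1 < p n"
    and p_unb: "\<And>B. \<exists>n. B < p n" and p_sum: "summable (\<lambda>n. inverse (p n))"
    using p unfolding fast_growing_def order_function_def by auto
  have p0: "0 < p n" for n using p1[of n] by simp
  define S where "S = (\<Sum>n. inverse (p n))"
  define t where "t n = S - (\<Sum>i<n. inverse (p i))" for n
  have t_step: "inverse (p n) = t n - t (Suc n)" for n by (simp add: t_def)
  have t_pos: "0 < t n" for n
    using sum_less_suminf[OF p_sum, of n] p0 by (simp add: t_def S_def)
  have t_dec: "t (Suc n) \<le> t n" for n using t_step[of n] positive_imp_inverse_positive[OF p0[of n]] by linarith
  have t_lim: "t \<longlonglongrightarrow> 0"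
    using tendsto_diff[OF tendsto_const summable_LIMSEQ[OF p_sum], of S]
    unfolding t_def[abs_def] S_def by simp

  obtain P where P: "total_recursive (\<lambda>z. P (pfst z) (psnd z))"
    "\<And>n k. \<bar>p n - real (P n k) / 2 ^ k\<bar> \<le> 2 / 2 ^ k"
    using recursive_real_functionE[OF p_rec] p0 by (meson less_imp_le)
  obtain I where I: "total_recursive (\<lambda>z. I (pfst z) (psnd z))"
    "\<And>n k. \<bar>inverse (p n) - real (I n k) / 2 ^ k\<bar> \<le> 2 / 2 ^ k"
    using inverse_approx[OF p_rec p1] by blast
  have "0 \<le> S" using t_pos[of 0] by (simp add: t_def)
  then obtain S' where "total_recursive (\<lambda>z. S' (pfst z) (psnd z))"
    "\<And>n k. \<bar>S - real (S' n k) / 2 ^ k\<bar> \<le> 2 / 2 ^ k"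
    using recursive_real_functionE[of "\<lambda>_. S"] rec unfolding recursive_real_iff S_def by blast
  then obtain s where s: "total_recursive s" "\<And>k. \<bar>S - real (s k) / 2 ^ k\<bar> \<le> 2 / 2 ^ k"
    using tr_comp[of "\<lambda>z. S' (pfst z) (psnd z)" "\<lambda>k. prod_encode (0, k)"] that[of "S' 0"]
    by (simp add: tr_intros)

  \<comment> \<open>\<open>V n\<close> estimates the tail from above at precision \<open>n\<close>:
    the 2 and the \<open>2 * n\<close> cover the errors of \<open>s n\<close> and of the
    \<open>n\<close> terms. In \<open>cert\<close> the comparison of \<open>V n\<close> with 4^-k is
    cleared of denominators, and the subtracted sum is moved to the right to avoid
    truncation.\<close>
  define cert where "cert n k \<longleftrightarrow>
      (s n + 2 + 2 * n) * 4 ^ k \<le> 2 ^ n + 4 ^ k * (\<Sum>i<n. I i n)" for n k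
  define V where "V n = (real (s n) + 2 + 2 * real n - (\<Sum>i<n. real (I i n))) / 2 ^ n" for n
  have cert: "cert n k \<longleftrightarrow> V n \<le> 1 / 4 ^ k" for n k
  proof -
    have "cert n k \<longleftrightarrow> real ((s n + 2 + 2 * n) * 4 ^ k) \<le> real (2 ^ n + 4 ^ k * (\<Sum>i<n. I i n))"
      unfolding cert_def of_nat_le_iff ..
    also have "\<dots> \<longleftrightarrow> V n \<le> 1 / 4 ^ k"
      unfolding V_def by (simp add: field_simps)
    finally show ?thesis .
  qed
  have V: "t n \<le> V n" "V n \<le> t n + (4 + 4 * real n) / 2 ^ n" for n
  proof -
    have "\<bar>(\<Sum>i<n. inverse (p i)) - (\<Sum>i<n. real (I i n) / 2 ^ n)\<bar> \<le> (\<Sum>i<n. 2 / 2 ^ n)"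
      unfolding sum_subtractf[symmetric] by (intro order_trans[OF sum_abs] sum_mono I(2))
    then have "\<bar>(\<Sum>i<n. inverse (p i)) - (\<Sum>i<n. real (I i n)) / 2 ^ n\<bar> \<le> 2 * real n / 2 ^ n"
      by (simp add: sum_divide_distrib mult.commute)
    moreover have "V n = real (s n) / 2 ^ n + 2 / 2 ^ n + 2 * real n / 2 ^ n - (\<Sum>i<n. real (I i n)) / 2 ^ n"
      unfolding V_def by (simp add: add_divide_distrib diff_divide_distrib)
    moreover have "(4 + 4 * real n) / 2 ^ n = 2 / 2 ^ n + 2 / 2 ^ n + 2 * real n / 2 ^ n + 2 * real n / 2 ^ n"
      by (simp flip: add_divide_distrib)
    ultimately show "t n \<le> V n" "V n \<le> t n + (4 + 4 * real n) / 2 ^ n"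
      using s(2)[of n] unfolding t_def by linarith+
  qed
  have "V \<longlonglongrightarrow> 0"
  proof (rule tendsto_sandwich[OF _ _ t_lim])
    show "(\<lambda>n. t n + (4 + 4 * real n) / 2 ^ n) \<longlonglongrightarrow> 0"
      using tendsto_add[OF t_lim nat_over_two_power_limit] by simp
  qed (use V in auto)
  then have "\<forall>\<^sub>F n in sequentially. cert n k" for k
    unfolding cert by (intro eventually_mono[OF order_tendstoD(2)[where a = "1 / 4 ^ k"]]) auto
  moreover have "total_recursive (\<lambda>z. I (psnd z) (pfst (pfst z)))"
    using tr_comp[OF I(1), of "\<lambda>z. prod_encode (psnd z, pfst (pfst z))"] by (simp add: tr_intros)
  then have "decidable (\<lambda>z. cert (pfst z) (psnd z))"
    unfolding cert_def by (intro tr_intros tr_comp[OF s(1)])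
  ultimately obtain \<kappa> where \<kappa>: "total_recursive \<kappa>" "mono \<kappa>" "\<kappa> 0 = 0"
    "\<And>n. \<kappa> n \<noteq> 0 \<Longrightarrow> \<exists>i\<le>n. cert i (\<kappa> n)" "\<And>b. \<exists>n. b \<le> \<kappa> n"
    using stepwise_counter[of cert] by blast
  \<comment> \<open>The tail decreases, so a certificate from an earlier stage stays valid.\<close>
  have t_le: "t n \<le> 1 / 4 ^ \<kappa> n" if n: "\<kappa> n \<noteq> 0" for n
  proof -
    obtain i where "i \<le> n" "V i \<le> 1 / 4 ^ \<kappa> n" using \<kappa>(4)[OF n] unfolding cert by blast
    then show ?thesis using decseqD[OF decseq_SucI[of t, OF t_dec], of i n] V(1)[of i] by linarith
  qed

  \<comment> \<open>The start \<open>p 0\<close> is undivided because \<open>\<kappa> 0 = 0\<close>;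
    this keeps \<open>q\<close> above 1.\<close>
  define q where "q = rec_nat (p 0) (\<lambda>m y. max y (p (Suc m) / 2 ^ \<kappa> (Suc m)))"
  have q0: "q 0 = p 0" and qS: "q (Suc n) = max (q n) (p (Suc n) / 2 ^ \<kappa> (Suc n))" for n
    by (simp_all add: q_def)
  have "mono q" by (rule incseq_SucI) (simp add: qS)
  then have q1: "1 < q n" for n using p1[of 0] monoD[of q 0 n] by (simp add: q0)
  have q_pos: "0 < q n" for n using q1[of n] by simp
  have q_ge: "p n / 2 ^ \<kappa> n \<le> q n" for n by (cases n) (simp_all add: q0 qS \<kappa>(3))

  \<comment> \<open>Rounding the quotient adds one unit to the two from \<open>P\<close>; maxima add
    none.\<close>
  define Q where "Q n k = rec_nat (P 0 k) (\<lambda>m y. max y (P (Suc m) k div 2 ^ \<kappa> (Suc m))) n" for n k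
  have Q: "\<bar>q n - real (Q n k) / 2 ^ k\<bar> \<le> real 3 / 2 ^ k" for n k
  proof (induction n)
    case 0
    have "2 / 2 ^ k \<le> (3 / 2 ^ k :: real)" by (intro divide_right_mono) auto
    then show ?case using P(2)[of 0 k] by (simp add: q0 Q_def)
  next
    case (Suc n)
    let ?a = "P (Suc n) k" and ?e = "2 ^ \<kappa> (Suc n)"
    have "\<bar>p (Suc n) / ?e - real ?a / ?e / 2 ^ k\<bar> = \<bar>p (Suc n) - real ?a / 2 ^ k\<bar> / ?e"
      by (simp add: field_simps flip: diff_divide_distrib)
    also have "\<dots> \<le> (2 / 2 ^ k) / 1" using P(2) by (intro frac_le) auto
    finally have 1: "\<bar>p (Suc n) / ?e - real ?a / ?e / 2 ^ k\<bar> \<le> 2 / 2 ^ k" by simp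
    have "real (?a div ?e) \<le> real ?a / ?e" "real ?a / ?e \<le> real (?a div ?e) + 1"
      using real_div_nat_bounds[of ?a ?e] by simp_all
    then have le: "real (?a div ?e) / 2 ^ k \<le> real ?a / ?e / 2 ^ k"
      and "real ?a / ?e / 2 ^ k \<le> (real (?a div ?e) + 1) / 2 ^ k"
      by (intro divide_right_mono; simp)+
    then have "real ?a / ?e / 2 ^ k \<le> real (?a div ?e) / 2 ^ k + 1 / 2 ^ k"
      by (simp only: add_divide_distrib)
    moreover have "\<bar>x - z\<bar> \<le> a + b" if "\<bar>x - y\<bar> \<le> a" "z \<le> y" "y \<le> z + b" for x y z a b :: real
      using that by linarith
    ultimately have "\<bar>p (Suc n) / ?e - real (?a div ?e) / 2 ^ k\<bar> \<le> 2 / 2 ^ k + 1 / 2 ^ k"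
      using 1 le by blast
    then have 2: "\<bar>p (Suc n) / ?e - real (?a div ?e) / 2 ^ k\<bar> \<le> real 3 / 2 ^ k" by simp
    have "real (Q (Suc n) k) / 2 ^ k = max (real (Q n k) / 2 ^ k) (real (?a div ?e) / 2 ^ k)"
      by (simp add: Q_def max_divide_distrib_right of_nat_max)
    then show ?case using 2 Suc unfolding qS by linarith
  qed
  have "total_recursive (\<lambda>z. P 0 (psnd z))"
    using tr_comp[OF P(1), of "\<lambda>z. prod_encode (0, psnd z)"] by (simp add: tr_intros)
  moreover have "total_recursive (\<lambda>z. P (Suc (pfst (psnd z))) (psnd (pfst z)))"
    using tr_comp[OF P(1), of "\<lambda>z. prod_encode (Suc (pfst (psnd z)), psnd (pfst z))"]
    by (simp add: tr_intros)
  ultimately have "total_recursive (\<lambda>z. Q (pfst z) (psnd z))"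
    unfolding Q_def by (intro tr_intros tr_max tr_comp[OF \<kappa>(1)])
  then have q_rec: "recursive_real_function q"
    by (rule recursive_real_functionI[OF _ tr_const Q])

  have "(\<Sum>i<m. inverse (q (i + n))) \<le> 2 / 2 ^ \<kappa> n" if n: "\<kappa> n \<noteq> 0" for n m
  proof -
    have "(\<Sum>i<m. inverse (q (i + n))) \<le> (\<Sum>i<m. 2 ^ \<kappa> (i + n) * inverse (p (i + n)))"
    proof (rule sum_mono)
      fix i
      show "inverse (q (i + n)) \<le> 2 ^ \<kappa> (i + n) * inverse (p (i + n))"
        using le_imp_inverse_le[OF q_ge[of "i + n"]] p0[of "i + n"] by (simp add: field_simps)
    qed
    also have "\<dots> \<le> 2 / 2 ^ \<kappa> n"
    proof (rule tail_sum_bound[where t = t, OF t_step t_pos t_dec])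
      show "t i \<le> 1 / 4 ^ \<kappa> i" if "n \<le> i" for i
        using n monoD[OF \<kappa>(2) that] by (intro t_le) simp
    qed
    finally show ?thesis .
  qed
  then have q_sum: "summable (\<lambda>n. inverse (q n))" "recursive_real (\<Sum>n. inverse (q n))"
    using recursive_real_suminf_inverse[OF q_rec q1 \<kappa>(1,5)] by blast+

  have "p n / q n \<le> p (Suc n) / q (Suc n)" for n
  proof -
    have "q (Suc n) * p n \<le> p (Suc n) * q n"
    proof (cases "p (Suc n) / 2 ^ \<kappa> (Suc n) \<le> q n")
      case True
      then have "q (Suc n) = q n" by (simp add: qS)
      then show ?thesis using monoD[OF \<open>mono p\<close>, of n "Suc n"] q_pos[of n] by simp
    next
      case False
      then have "q (Suc n) * p n = p (Suc n) * (p n / 2 ^ \<kappa> (Suc n))" by (simp add: qS)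
      also have "p n / 2 ^ \<kappa> (Suc n) \<le> p n / 2 ^ \<kappa> n"
        using monoD[OF \<kappa>(2), of n "Suc n"] p0[of n] by (intro divide_left_mono power_increasing) auto
      also have "\<dots> \<le> q n" by (rule q_ge)
      finally show ?thesis using p0[of "Suc n"] by simp
    qed
    then show ?thesis using q_pos[of n] q_pos[of "Suc n"] by (simp add: field_simps)
  qed
  then have ratio: "mono (\<lambda>n. p n / q n)" by (rule incseq_SucI)
  have "filterlim (\<lambda>n. p n / q n) at_top sequentially"
    unfolding filterlim_at_top eventually_sequentially
  proof
    fix B :: real
    obtain N where N: "nat \<lceil>B\<rceil> \<le> \<kappa> N" using \<kappa>(5) by blast
    have "B \<le> real (\<kappa> N)" using N by linarith
    also have "\<dots> \<le> 2 ^ \<kappa> N" using less_exp[of "\<kappa> N"] by (metis less_imp_le of_nat_le_iff of_nat_numeral of_nat_power)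
    finally have B: "B \<le> 2 ^ \<kappa> N" .
    \<comment> \<open>Terms entering the maximum after \<open>N\<close> have numerator at most
      \<open>p n\<close> and denominator at least \<open>2 ^ \<kappa> N\<close>; the earlier ones
      are collected in \<open>q N\<close>.\<close>
    have q_le: "q n \<le> max (q N) (p n / 2 ^ \<kappa> N)" if "n \<ge> N" for n
      using that
    proof (induction n rule: dec_induct)
      case (step n)
      have "p n / 2 ^ \<kappa> N \<le> p (Suc n) / 2 ^ \<kappa> N"
        using monoD[OF \<open>mono p\<close>, of n "Suc n"] by (intro divide_right_mono) auto
      moreover have "p (Suc n) / 2 ^ \<kappa> (Suc n) \<le> p (Suc n) / 2 ^ \<kappa> N"
        using monoD[OF \<kappa>(2), of N "Suc n"] step p0[of "Suc n"]
        by (intro divide_left_mono power_increasing) auto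
      ultimately show ?case using step.IH unfolding qS by linarith
    qed simp
    \<comment> \<open>Unboundedness of \<open>p\<close> beats the fixed quantity involving
      \<open>q N\<close>; exceeding \<open>p N\<close> places \<open>n\<close> after
      \<open>N\<close>.\<close>
    obtain n where n: "max (\<bar>B\<bar> * q N) (p N) < p n" using p_unb by blast
    have "N \<le> n" using n monoD[OF \<open>mono p\<close>, of n N] by (meson leD le_cases max_less_iff_conj)
    have "B * q n \<le> p n"
    proof (cases "B \<le> 0")
      case True
      then show ?thesis using q_pos[of n] p0[of n] by (meson less_imp_le mult_nonpos_nonneg order_trans)
    next
      case False
      have "B * q n \<le> B * max (q N) (p n / 2 ^ \<kappa> N)"
        using False q_le[OF \<open>N \<le> n\<close>] by (intro mult_left_mono) auto
      moreover have "B * q N \<le> p n" using n False by simp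
      moreover have "B * (p n / 2 ^ \<kappa> N) \<le> 2 ^ \<kappa> N * (p n / 2 ^ \<kappa> N)"
        using B p0[of n] by (intro mult_right_mono) auto
      ultimately show ?thesis by (auto simp: max_def split: if_splits)
    qed
    then have "B \<le> p n / q n" using q_pos[of n] by (simp add: field_simps)
    then have "B \<le> p m / q m" if "m \<ge> n" for m
      using monoD[OF ratio that] by simp
    then show "\<exists>n. \<forall>m\<ge>n. B \<le> p m / q m" by blast
  qed
  moreover have "order_function q"
    unfolding order_function_def
    using q_rec \<open>mono q\<close> summable_inverse_unbounded[OF q_pos q_sum(1)] by blast
  ultimately show ?thesis
    unfolding summable_companion_def increases_to_infinity_def
    using ratio q1 q_sum by blast
qed

section \<open>The reduction\<close>

lemma floor_log_recursive:
  assumes "order_function p" "\<And>n. 1 < p n"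
  shows "\<exists>\<nu>. total_recursive \<nu> \<and> (\<forall>m. 2 ^ \<nu> m - 1 < p m \<and> p m < 2 ^ (\<nu> m + 1))"
proof -
  have "0 \<le> p n" for n using assms(2)[of n] by simp
  then obtain P where P: "total_recursive (\<lambda>z. P (pfst z) (psnd z))"
    "\<And>n k. \<bar>p n - real (P n k) / 2 ^ k\<bar> \<le> 2 / 2 ^ k"
    using recursive_real_functionE assms(1) unfolding order_function_def by blast
  define r where "r m = P m 3" for m
  have r: "\<bar>p m - real (r m) / 8\<bar> \<le> 1 / 4" for m using P(2)[of m 3] by (simp add: r_def)
  have tr: "total_recursive r"
    unfolding r_def using tr_comp[OF P(1), of "\<lambda>m. prod_encode (m, 3)"] by (simp add: tr_intros)
  \<comment> \<open>The error of \<open>r m / 8\<close> is 1/4 and the margin is 4/8, so for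
    positive \<open>\<nu> m\<close> minimality gives \<open>p m >= 2 ^ \<nu> m - 3/4\<close>.
    Approximations cannot decide \<open>2 ^ \<nu> m <= p m\<close>, but the weaker bound still puts
    all integers below \<open>2 ^ \<nu> m\<close> below \<open>p m\<close>.\<close>
  define \<nu> where "\<nu> m = (LEAST n. r m + 4 < 8 * 2 ^ (n + 1))" for m
  have ex: "\<exists>n. r m + 4 < 8 * 2 ^ (n + 1)" for m
    using less_exp[of "r m + 4"] by (intro exI[of _ "r m + 4"]) (simp only: power_add, simp)
  have "total_recursive \<nu>"
    unfolding \<nu>_def by (rule tr_Least) (intro tr_intros tr_comp[OF tr] ex)+
  moreover have "2 ^ \<nu> m - 1 < p m \<and> p m < 2 ^ (\<nu> m + 1)" for m
  proof
    have "r m + 4 < 8 * 2 ^ (\<nu> m + 1)" unfolding \<nu>_def by (rule LeastI_ex[OF ex])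
    then have "real (r m + 4) < real (8 * 2 ^ (\<nu> m + 1))" unfolding of_nat_less_iff .
    then show "p m < 2 ^ (\<nu> m + 1)" using r[of m] unfolding abs_le_iff by simp
    show "2 ^ \<nu> m - 1 < p m"
    proof (cases "\<nu> m")
      case 0
      then show ?thesis using assms(2)[of m] by simp
    next
      case (Suc n)
      then have "\<not> r m + 4 < 8 * 2 ^ (n + 1)"
        unfolding \<nu>_def by (intro not_less_Least) simp
      then have "real (8 * 2 ^ \<nu> m) \<le> real (r m + 4)"
        unfolding of_nat_le_iff by (simp add: Suc)
      then show ?thesis using r[of m] unfolding abs_le_iff by simp
    qed
  qed
  ultimately show ?thesis by blast
qed

text \<open>A running maximum makes the lengths nondecreasing, as Kraft's code requires; it stays
  within 4 of \<open>q\<close> because \<open>q\<close> is monotone. The factor 16 will cost 4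
  bits.\<close>

lemma ceiling_log_recursive:
  assumes "order_function q" "\<And>n. 1 < q n"
  shows "\<exists>l. total_recursive l \<and> mono l \<and> (\<forall>m. q m \<le> 2 ^ l m \<and> 2 ^ l m \<le> 16 * q m)"
proof -
  obtain B where B: "total_recursive B" "\<And>n. q n \<le> real (B n)" "\<And>n. real (B n) \<le> q n + 4"
    using order_function_bounds[OF assms] by blast
  have "mono q" using assms(1) unfolding order_function_def by blast
  define A where "A n = rec_nat (B 0) (\<lambda>m y. max y (B (Suc m))) n" for n
  have trA: "total_recursive A"
    unfolding A_def by (intro tr_intros tr_max tr_comp[OF B(1)])
  have A: "q n \<le> real (A n) \<and> real (A n) \<le> q n + 4" for n
  proof (induction n)
    case (Suc n)
    then show ?case
      using B(2,3)[of "Suc n"] monoD[OF \<open>mono q\<close>, of n "Suc n"] by (simp add: A_def of_nat_max)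
  qed (simp add: A_def B)
  have "mono A" by (rule incseq_SucI) (simp add: A_def)
  define l where "l n = (LEAST l. A n \<le> 2 ^ l)" for n
  have ex: "\<exists>l. A n \<le> 2 ^ l" for n by (meson less_exp less_imp_le)
  have l: "A n \<le> 2 ^ l n" for n unfolding l_def by (rule LeastI_ex[OF ex])
  have "total_recursive l"
    unfolding l_def by (rule tr_Least) (intro tr_intros tr_comp[OF trA] ex)+
  moreover have "mono l"
  proof
    fix m n :: nat assume "m \<le> n"
    then have "A m \<le> 2 ^ l n" using monoD[OF \<open>mono A\<close>, of m n] l[of n] by linarith
    then show "l m \<le> l n" unfolding l_def[of m] by (rule Least_le)
  qed
  moreover have "q m \<le> 2 ^ l m \<and> 2 ^ l m \<le> 16 * q m" for m
  proof
    have "real (A m) \<le> real (2 ^ l m)" using l unfolding of_nat_le_iff .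
    then show "q m \<le> 2 ^ l m" using A[of m] unfolding of_nat_power of_nat_numeral by linarith
    show "2 ^ l m \<le> 16 * q m"
    proof (cases "l m")
      case 0
      then show ?thesis using assms(2)[of m] by simp
    next
      case (Suc k)
      then have "\<not> A m \<le> 2 ^ k" unfolding l_def by (intro not_less_Least) simp
      then have "real (2 ^ l m) \<le> real (2 * A m)" unfolding of_nat_le_iff by (simp add: Suc)
      then show ?thesis using A[of m] assms(2)[of m] by simp
    qed
  qed
  ultimately show ?thesis by blast
qed

text \<open>
  Kraft's code for nondecreasing lengths: the \<open>j\<close>-th code word consists of the first \<open>\<lambda> j\<close> binary
  digits of the sum of all \<open>2\<^sup>-\<^sup>\<lambda>\<^sup>i\<close> with \<open>i < j\<close>.
\<close>

definition kraft :: "(nat \<Rightarrow> nat) \<Rightarrow> nat \<Rightarrow> nat" where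
  "kraft L j = (\<Sum>i<j. 2 ^ (L j - L i))"

lemma kraft_less:
  assumes "mono L" "\<And>j. (\<Sum>i<j. 1 / 2 ^ L i) \<le> (1 :: real)"
  shows "kraft L j < 2 ^ L j"
proof -
  have "real (kraft L j) = (\<Sum>i<j. 2 ^ L j * (1 / 2 ^ L i))"
    unfolding kraft_def of_nat_sum of_nat_power of_nat_numeral using monoD[OF assms(1)]
    by (intro sum.cong) (auto simp: power_diff)
  also have "\<dots> + 1 = 2 ^ L j * (\<Sum>i<Suc j. 1 / 2 ^ L i)"
    by (simp add: sum_distrib_left distrib_left)
  also have "\<dots> \<le> 2 ^ L j * 1" by (intro mult_left_mono assms(2)) simp
  finally have "real (kraft L j + 1) \<le> real (2 ^ L j)" by simp
  then show ?thesis unfolding of_nat_le_iff by simp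
qed

text \<open>Rescaled to the denominator \<open>2 ^ L j\<close>, the partial sum through
  \<open>i\<close> is a subsum of the one defining \<open>kraft L j\<close>.\<close>

lemma kraft_step:
  assumes "mono L" "i < j"
  shows "(kraft L i + 1) * 2 ^ (L j - L i) \<le> kraft L j"
proof -
  have "(kraft L i + 1) * 2 ^ (L j - L i) = (\<Sum>t<Suc i. 2 ^ (L i - L t) * 2 ^ (L j - L i))"
    by (simp add: kraft_def sum_distrib_right)
  also have "\<dots> = (\<Sum>t<Suc i. 2 ^ (L j - L t))"
  proof (rule sum.cong)
    fix t assume "t \<in> {..<Suc i}"
    then have "L t \<le> L i" "L i \<le> L j" using assms monoD[OF assms(1)] by auto
    then show "(2::nat) ^ (L i - L t) * 2 ^ (L j - L i) = 2 ^ (L j - L t)"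
      by (simp flip: power_add)
  qed simp
  also have "\<dots> \<le> kraft L j" unfolding kraft_def using assms(2) by (intro sum_mono2) auto
  finally show ?thesis .
qed

text \<open>For \<open>i < j\<close> the first \<open>L i\<close> digits of word \<open>j\<close>
  form the number \<open>kraft L j div 2 ^ d\<close>, which \<open>kraft_step\<close> pushes past
  \<open>kraft L i\<close>.\<close>

lemma kraft_prefix_free:
  assumes L: "mono L" "\<And>j. (\<Sum>i<j. 1 / 2 ^ L i) \<le> (1 :: real)"
    and pre: "prefix (bits (kraft L i) (L i)) (bits (kraft L j) (L j))"
  shows "i = j"
proof -
  have no: "\<not> prefix (bits (kraft L i) (L i)) (bits (kraft L j) (L j))" if "i < j" for i j
  proof
    assume pre: "prefix (bits (kraft L i) (L i)) (bits (kraft L j) (L j))"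
    have le: "L i \<le> L j" using monoD[OF L(1)] that by simp
    define d where "d = L j - L i"
    have Lj: "L j = L i + d" using le by (simp add: d_def)
    have "bits (kraft L i) (L i) = take (L i) (bits (kraft L j) (L i + d))"
      using pre unfolding Lj by (metis append_eq_conv_conj length_bits prefixE)
    also have "\<dots> = bits (kraft L j div 2 ^ d) (L i)" by (rule take_bits)
    finally have "kraft L i = kraft L j div 2 ^ d"
    proof (rule bits_inj)
      show "kraft L i < 2 ^ L i" by (rule kraft_less[OF L])
      show "kraft L j div 2 ^ d < 2 ^ L i"
        using kraft_less[OF L, of j] unfolding Lj by (simp add: less_mult_imp_div_less power_add)
    qed
    moreover have "kraft L i + 1 \<le> kraft L j div 2 ^ d"
      using kraft_step[OF L(1) that] unfolding d_def[symmetric]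
      by (simp add: less_eq_div_iff_mult_less_eq del: add_Suc_right)
    ultimately show False by simp
  qed
  \<comment> \<open>In the opposite order monotone lengths force equal lengths, hence equal words,
    and the first case applies with the roles exchanged.\<close>
  show ?thesis
  proof (rule ccontr)
    assume "i \<noteq> j"
    then have "j < i" using no pre by (meson linorder_neqE_nat)
    then have "L j \<le> L i" using monoD[OF L(1)] by simp
    moreover have "L i \<le> L j" using prefix_length_le[OF pre] by simp
    ultimately have "bits (kraft L i) (L i) = bits (kraft L j) (L j)"
      using pre by (metis length_bits le_antisym not_equal_is_parallel parallelE)
    then show False using no[OF \<open>j < i\<close>] by simp
  qed
qed

section \<open>Reading initial segments from the oracle\<close>

lemma bits_prefix_value:
  fixes X :: "nat \<Rightarrow> bool"
  defines "y n \<equiv> rec_nat 0 (\<lambda>i y. 2 * y + of_bool (X i)) n"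
  shows "bits (y n) n = map X [0..<n] \<and> y n < 2 ^ n"
proof (induction n)
  case 0
  then show ?case by (simp add: y_def)
next
  case (Suc n)
  have y: "y (Suc n) = 2 * y n + of_bool (X n)" by (simp add: y_def)
  have "(2 * y n + of_bool (X n)) div 2 = y n" by simp
  then show ?case using Suc unfolding y bits_snoc by auto
qed

text \<open>The closure lemmas concern oracle-free programs, so this program, the only one to query
  the oracle, is assembled by hand.\<close>

lemma prefix_value_functional:
  assumes "total_recursive \<nu>"
  shows "partial_recursive_functional (\<lambda>X m. Some (rec_nat 0 (\<lambda>i y. 2 * y + X i) (\<nu> m)))"
proof -
  have "total_recursive (\<lambda>z. 2 * psnd z + pfst z)" by (intro tr_intros)
  then obtain d where d: "run d = (\<lambda>X z. Some (2 * psnd z + pfst z))"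
    by (rule total_recursiveE)
  obtain e where e: "run e = (\<lambda>X m. Some (\<nu> m))"
    using assms by (rule total_recursiveE)
  let ?step = "PComp d (PPair (PComp POracle (PComp PFst PSnd)) (PComp PSnd PSnd))"
  have "rec_nat (Some 0) (\<lambda>m r. Option.bind r (\<lambda>y. run ?step X (prod_encode (a, prod_encode (m, y))))) k =
      Some (rec_nat 0 (\<lambda>i y. 2 * y + X i) k)" for X a k
    by (induction k) (auto simp: d)
  then have "run (PComp (PRec PZero ?step) (PPair PZero e)) =
      (\<lambda>X m. Some (rec_nat 0 (\<lambda>i y. 2 * y + X i) (\<nu> m)))"
    by (intro ext) (simp add: e)
  then show ?thesis unfolding partial_recursive_functional_def by blast
qed

text \<open>The value at \<open>a * (i + 1)\<close> is at most the average over the block of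
  \<open>a\<close> arguments before it. The argument 0 has no such block, hence the shift by
  one.\<close>

lemma sum_multiples_le:
  fixes f :: "nat \<Rightarrow> real"
  assumes "antimono f" "\<And>n. 0 \<le> f n" "summable f"
  shows "real a * (\<Sum>i<j. f (a * (i + 1))) \<le> (\<Sum>n. f n)"
proof -
  have "real a * f (a * (i + 1)) \<le> sum f {i * a..<i * a + a}" for i
  proof -
    have "real a * f (a * (i + 1)) = (\<Sum>t\<in>{i * a..<i * a + a}. f (a * (i + 1)))" by simp
    also have "\<dots> \<le> sum f {i * a..<i * a + a}"
      by (intro sum_mono antimonoD[OF assms(1)]) (auto simp: algebra_simps)
    finally show ?thesis .
  qed
  then have "(\<Sum>i<j. real a * f (a * (i + 1))) \<le> (\<Sum>i<j. sum f {i * a..<i * a + a})"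
    by (rule sum_mono)
  also have "\<dots> = sum f {..<j * a}" by (rule sum.nat_group)
  also have "\<dots> \<le> (\<Sum>n. f n)" using assms by (intro sum_le_suminf) auto
  finally show ?thesis by (simp add: sum_distrib_left)
qed

text \<open>Arithmetic progressions go to arithmetic progressions. Divergence off the positive
  multiples of \<open>a\<close> leaves only arguments covered by \<open>sum_multiples_le\<close> to
  be avoided.\<close>

lemma linearly_universal_dilate:
  assumes "linearly_universal \<psi>" "a > 0"
  shows "\<exists>\<phi>. linearly_universal \<phi> \<and> (\<forall>x. \<phi> (a * (x + 1)) = \<psi> x) \<and>
    (\<forall>m. m \<notin> range (\<lambda>x. a * (x + 1)) \<longrightarrow> \<phi> m = None)"
proof -
  have "total_recursive (\<lambda>x. a * (x + 1))" by (intro tr_intros)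
  moreover have "inj (\<lambda>x. a * (x + 1))" using assms(2) by (auto simp: inj_def)
  moreover have "partial_recursive \<psi>" using assms(1) unfolding linearly_universal_def by blast
  ultimately obtain \<phi> where \<phi>: "partial_recursive \<phi>" "\<And>x. \<phi> (a * (x + 1)) = \<psi> x"
    "\<And>m. m \<notin> range (\<lambda>x. a * (x + 1)) \<Longrightarrow> \<phi> m = None"
    using partial_recursive_transport by blast
  have "\<exists>b c. \<forall>x. \<phi> (b * x + c) = \<theta> x" if \<theta>: "partial_recursive \<theta>" for \<theta>
  proof -
    obtain b c where bc: "\<And>x. \<psi> (b * x + c) = \<theta> x"
      using assms(1) \<theta> unfolding linearly_universal_def by blast
    have "\<phi> ((a * b) * x + a * (c + 1)) = \<theta> x" for x
      using \<phi>(2)[of "b * x + c"] bc[of x] by (simp add: algebra_simps)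
    then show ?thesis by blast
  qed
  then show ?thesis using \<phi> unfolding linearly_universal_def by blast
qed

text \<open>
  For the dilation by \<open>4\<^sup>k\<close> the code words are shortened by \<open>2 k\<close> bits, whereas the marker \<open>0\<^sup>k1\<close>
  that announces \<open>k\<close> costs only \<open>k + 1\<close>.
\<close>

lemma LUA_reducible_to_COMPLEX:
  assumes U: "universal_machine U"
    and p: "order_function p" "\<And>n. 1 < p n"
    and q: "order_function q" "\<And>n. 1 < q n" "summable (\<lambda>n. inverse (q n))"
  shows "LUA p \<le>\<^sub>s COMPLEX U (complexity_bound p q)"
proof -
  obtain \<nu> where \<nu>: "total_recursive \<nu>" "\<And>m. 2 ^ \<nu> m - 1 < p m" "\<And>m. p m < 2 ^ (\<nu> m + 1)"
    using floor_log_recursive[OF p] by blast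
  obtain l where l: "total_recursive l" "mono l" "\<And>m. q m \<le> 2 ^ l m" "\<And>m. 2 ^ l m \<le> 16 * q m"
    using ceiling_log_recursive[OF q(1,2)] by blast
  obtain \<psi> where \<psi>: "linearly_universal \<psi>" using linearly_universal_exists[OF U] by blast
  then have \<psi>_rec: "partial_recursive \<psi>" unfolding linearly_universal_def by blast
  have "mono q" using q(1) unfolding order_function_def by blast
  have q_pos: "0 < q n" for n using q(2)[of n] by simp

  obtain s where s: "(\<Sum>n. inverse (q n)) \<le> 2 ^ s"
  proof
    let ?s = "nat \<lceil>\<Sum>n. inverse (q n)\<rceil>"
    have "(\<Sum>n. inverse (q n)) \<le> real ?s" by linarith
    also have "\<dots> \<le> 2 ^ ?s" by (metis less_exp less_imp_le of_nat_le_iff of_nat_numeral of_nat_power)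
    finally show "(\<Sum>n. inverse (q n)) \<le> 2 ^ ?s" .
  qed
  have weight: "4 ^ k * (\<Sum>i<j. 1 / 2 ^ l (4 ^ k * (i + 1))) \<le> (2 ^ s :: real)" for k j
  proof -
    have "(\<Sum>i<j. 1 / 2 ^ l (4 ^ k * (i + 1))) \<le> (\<Sum>i<j. inverse (q (4 ^ k * (i + 1))))"
      using l(3) q_pos by (intro sum_mono) (simp add: inverse_eq_divide frac_le)
    then have "4 ^ k * (\<Sum>i<j. 1 / 2 ^ l (4 ^ k * (i + 1))) \<le>
        real (4 ^ k) * (\<Sum>i<j. inverse (q (4 ^ k * (i + 1))))"
      by simp
    also have "\<dots> \<le> (\<Sum>n. inverse (q n))"
    proof (rule sum_multiples_le)
      show "antimono (\<lambda>n. inverse (q n))"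
        using monoD[OF \<open>mono q\<close>] q_pos by (intro antimonoI le_imp_inverse_le)
    qed (use q_pos q(3) in \<open>auto intro: less_imp_le\<close>)
    finally show ?thesis using s by simp
  qed
  \<comment> \<open>A single term of \<open>weight\<close> shows this; it makes the subtraction in
    \<open>L\<close> exact.\<close>
  have long: "2 * k \<le> l (4 ^ k * (j + 1)) + s" for k j
  proof -
    have "4 ^ k * (1 / 2 ^ l (4 ^ k * (j + 1))) \<le>
        4 ^ k * (\<Sum>i<Suc j. 1 / (2 :: real) ^ l (4 ^ k * (i + 1)))"
      by (intro mult_left_mono member_le_sum[where f = "\<lambda>i. 1 / 2 ^ l (4 ^ k * (i + 1))"]) auto
    also have "\<dots> \<le> 2 ^ s" by (rule weight)
    finally have "(4::real) ^ k \<le> 2 ^ (l (4 ^ k * (j + 1)) + s)"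
      by (simp add: power_add field_simps)
    then have "(2::real) ^ (2 * k) \<le> 2 ^ (l (4 ^ k * (j + 1)) + s)"
      unfolding power_mult by simp
    then show ?thesis by simp
  qed

  \<comment> \<open>The summand \<open>s\<close> scales the total weight to at most 1;
    \<open>2 * k\<close> is the saving from the dilation by \<open>4 ^ k\<close>.\<close>
  define L where "L k j = l (4 ^ k * (j + 1)) + s - 2 * k" for k j
  have L_mono: "mono (L k)" for k
    unfolding L_def by (intro monoI diff_le_mono add_right_mono monoD[OF l(2)] mult_left_mono) auto
  have L_kraft: "(\<Sum>i<j. 1 / 2 ^ L k i) \<le> (1 :: real)" for k j
  proof -
    have "1 / 2 ^ L k i = 4 ^ k / 2 ^ s * (1 / (2 :: real) ^ l (4 ^ k * (i + 1)))" for i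
    proof -
      have "L k i + 2 * k = l (4 ^ k * (i + 1)) + s" using long[of k i] by (simp add: L_def)
      then have "(2 :: real) ^ L k i * 4 ^ k = 2 ^ l (4 ^ k * (i + 1)) * 2 ^ s"
        using power_add[of "2::real" "L k i" "2 * k"]
        by (simp add: power_mult flip: power_add)
      then show ?thesis by (simp add: field_simps)
    qed
    then have "(\<Sum>i<j. 1 / 2 ^ L k i) = 4 ^ k * (\<Sum>i<j. 1 / (2 :: real) ^ l (4 ^ k * (i + 1))) / 2 ^ s"
      by (simp only: sum_distrib_left sum_divide_distrib times_divide_eq_left)
    also have "\<dots> \<le> 1" using weight[of k j] by simp
    finally show ?thesis .
  qed

  \<comment> \<open>The summand \<open>2 ^ L k j\<close> supplies the 1 that ends the marker; the
    Kraft word for \<open>j\<close> follows it.\<close>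
  define str where "str z = (let k = pfst z; j = psnd z in
      bits (2 ^ L k j + kraft (L k) j) (Suc k + L k j))" for z
  \<comment> \<open>With \<open>m = 4 ^ k * (j + 1)\<close>, a correct guess
    \<open>\<psi> j = Some (Y m)\<close> makes the output the initial segment of \<open>X\<close> of
    length \<open>\<nu> m\<close>.\<close>
  define out where "out z = map_option (\<lambda>y. bits y (\<nu> (4 ^ pfst z * (psnd z + 1)))) (\<psi> (psnd z))" for z
  have str: "str (prod_encode (k, j)) =
      replicate k False @ True # bits (kraft (L k) j) (L k j)" for k j
    using bits_append[OF kraft_less[OF L_mono L_kraft, of k j], of 1 "Suc k"]
    by (simp add: str_def bits_one[unfolded One_nat_def] del: bits.simps)
  have "\<exists>\<rho>. \<forall>z. U (\<rho> @ str z) = out z"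
  proof (rule universal_machine_simulates[OF U])
    show "total_recursive (\<lambda>z. string_code (str z))"
      unfolding str_def Let_def kraft_def L_def
      by (intro tr_string_code_bits tr_intros tr_comp[OF l(1)])
    show "partial_recursive (\<lambda>z. map_option string_code (out z))"
      unfolding out_def option.map_comp comp_def
      by (intro pr_map pr_comp_total[OF \<psi>_rec] tr_string_code_bits tr_intros tr_comp[OF \<nu>(1)])
    show "z = z'" if "prefix (str z) (str z')" for z z'
    proof -
      obtain k j k' j' where z: "z = prod_encode (k, j)" "z' = prod_encode (k', j')"
        by (metis prod_decode_inverse surj_pair)
      have "k = k'" "prefix (bits (kraft (L k) j) (L k j)) (bits (kraft (L k) j') (L k j'))"
        using that unfolding z str prefix_replicate_False by auto
      then show ?thesis using kraft_prefix_free[OF L_mono L_kraft] z by blast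
    qed
  qed
  then obtain \<rho> where \<rho>: "\<And>z. U (\<rho> @ str z) = out z" by blast

  define \<Phi> where "\<Phi> X m = Some (rec_nat 0 (\<lambda>i y. 2 * y + X i) (\<nu> m))" for X :: "nat \<Rightarrow> nat" and m
  have "\<exists>Y\<in>LUA p. \<Phi> X' = (\<lambda>n. Some (Y n))" if mem: "X' \<in> COMPLEX U (complexity_bound p q)" for X'
  proof -
    obtain X c where X': "X' = (\<lambda>n. of_bool (X n))"
      and c: "\<And>n. complexity_bound p q n - real c \<le> real (prefix_complexity U (map X [0..<n]))"
      using mem unfolding COMPLEX_def by blast
    define Y where "Y m = rec_nat 0 (\<lambda>i y. 2 * y + X' i) (\<nu> m)" for m
    have Y: "bits (Y m) (\<nu> m) = map X [0..<\<nu> m]" "Y m < 2 ^ \<nu> m" for m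
      unfolding Y_def X' using bits_prefix_value[of X "\<nu> m"] by auto
    have Y_less: "real (Y m) < p m" for m
    proof -
      have "real (Y m + 1) \<le> real (2 ^ \<nu> m)" unfolding of_nat_le_iff using Y(2)[of m] by simp
      then show ?thesis using \<nu>(2)[of m] by simp
    qed
    \<comment> \<open>\<open>\<Phi>\<close> does not involve \<open>k\<close>: only the linearly
      universal function, which \<open>LUA\<close> lets vary with the sequence, depends on
      \<open>c\<close>. A coincidence would yield \<open>k <= c + length \<rho> + s + 5\<close>,
      with 1 from the end of the marker and 4 from \<open>ceiling_log_recursive\<close>.\<close>
    define k where "k = c + length \<rho> + s + 6"
    obtain \<phi> where \<phi>: "linearly_universal \<phi>" "\<And>x. \<phi> (4 ^ k * (x + 1)) = \<psi> x"
      "\<And>m. m \<notin> range (\<lambda>x. 4 ^ k * (x + 1)) \<Longrightarrow> \<phi> m = None"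
      using linearly_universal_dilate[OF \<psi>, of "4 ^ k"] by auto
    have "\<phi> m \<noteq> Some (Y m)" for m
    proof
      assume eq: "\<phi> m = Some (Y m)"
      then obtain j where m: "m = 4 ^ k * (j + 1)" using \<phi>(3)[of m] by fastforce
      have "\<psi> j = Some (Y m)" using eq \<phi>(2)[of j] m by simp
      then have "out (prod_encode (k, j)) = Some (map X [0..<\<nu> m])"
        using Y(1)[of m] m by (simp add: out_def)
      then have "prefix_complexity U (map X [0..<\<nu> m]) \<le> length (\<rho> @ str (prod_encode (k, j)))"
        unfolding prefix_complexity_def using \<rho>
        by (intro Least_le exI[of _ "\<rho> @ str (prod_encode (k, j))"] conjI) auto
      then have "prefix_complexity U (map X [0..<\<nu> m]) \<le> length \<rho> + k + 1 + L k j"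
        by (simp add: str)
      moreover have "L k j + 2 * k = l m + s" using long[of k j] by (simp add: L_def m)
      ultimately have K: "real (prefix_complexity U (map X [0..<\<nu> m])) + real k \<le>
          real (length \<rho>) + 1 + real (l m) + real s"
        by linarith
      have "real (l m) \<le> log 2 (q m) + 4"
      proof -
        have "real (l m) = log 2 (2 ^ l m)" by simp
        also have "\<dots> \<le> log 2 (2 ^ 4 * q m)" using l(4)[of m] q_pos[of m] by (intro log_mono) auto
        also have "\<dots> = log 2 (2 ^ 4) + log 2 (q m)" using q_pos[of m] by (intro log_mult_pos) auto
        also have "log 2 (2 ^ 4 :: real) = 4" using log_pow_cancel[of "2::real" 4] by simp
        finally show ?thesis by simp
      qed
      \<comment> \<open>Since \<open>p m < 2 ^ (\<nu> m + 1)\<close>, the bound for this length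
        evaluates \<open>q\<close> no earlier than at \<open>m\<close>.\<close>
      moreover obtain M where M: "m \<le> M" "complexity_bound p q (\<nu> m) = log 2 (q M)"
        using complexity_bound_eq[OF p(1) \<nu>(3), where q = q] by blast
      moreover have "log 2 (q m) \<le> log 2 (q M)"
        using monoD[OF \<open>mono q\<close> M(1)] q_pos[of m] by (intro log_mono) auto
      ultimately show False using c[of "\<nu> m"] K unfolding k_def by simp
    qed
    then have "Y \<in> LUA p" unfolding LUA_def using Y_less \<phi>(1) by blast
    then show ?thesis by (rule bexI[rotated]) (simp add: \<Phi>_def Y_def fun_eq_iff)
  qed
  moreover have "partial_recursive_functional \<Phi>"
    using prefix_value_functional[OF \<nu>(1)] unfolding \<Phi>_def .
  ultimately show ?thesis unfolding strongly_reducible_def by blast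
qed

theorem mainTheorem13:
  fixes p :: "nat \<Rightarrow> real" and U :: "bool list \<Rightarrow> bool list option"
  assumes "universal_machine U"
    and "fast_growing p"
    and "recursive_real (\<Sum>n. inverse (p n))"
  shows "(\<forall>q. summable_companion p q \<longrightarrow> LUA p \<le>\<^sub>s COMPLEX U (complexity_bound p q)) \<and>
         (\<exists>q. summable_companion p q) \<and>
         (\<forall>q. summable_companion p q \<longrightarrow>
            (\<exists>g. convex_order g \<and> sub_identical g \<and> recursive_real_function g \<and>
                 dominated_by (complexity_bound p q) g))"
proof -
  have p: "order_function p" "\<And>n. 1 < p n"
    using assms(2) unfolding fast_growing_def by auto
  have "LUA p \<le>\<^sub>s COMPLEX U (complexity_bound p q)" if "summable_companion p q" for q
    using that unfolding summable_companion_def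
    by (intro LUA_reducible_to_COMPLEX[OF assms(1) p]) auto
  then show ?thesis
    using companion_exists[OF assms(2,3)] complexity_bound_dominated[OF p] by blast
qed

end
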